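(* Let $K$ be a nonarchimedean local field and let $B$ be a non-commutative central division $K$-algebra with $\dim_K B=n^2$. Let $\mathfrak{D}$ be a maximal order of $\mathbb{M}_2(B)$, let $\mathcal{M}_{\mathfrak{D}}$ be its unique maximal two-sided ideal, and set $$\mathfrak{D}^{[2]}=\{x\in\mathfrak{D}\mid \bar x\in Z(\mathfrak{D}/\mathcal{M}_{\mathfrak{D}}^2)\},$$ where $\bar x$ is the image of $x$ in $\mathfrak{D}/\mathcal{M}_{\mathfrak{D}}^2$ and $Z(R)$ denotes the center of a ring $R$. Let $\mathfrak{H}\subseteq\mathbb{M}_2(B)$ be an order contained in $\mathfrak{D}^{[2]}$. Then $\mathfrak{H}$ is not the intersection of three maximal orders of $\mathbb{M}_2(B)$. However, $\mathfrak{D}^{[2]}$ is the intersection of a finite family of maximal orders of $\mathbb{M}_2(B)$.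
   Context: Orders in $\mathbb{M}_2(B)$ are $\mathcal{O}_K$-orders, where $\mathcal{O}_K$ is the ring of integers of $K$. *)

theory Defs
  imports
    "HOL-Analysis.Finite_Cartesian_Product"
    "HOL-Algebra.Subrings"
    "HOL-Algebra.Ideal_Product"
begin

text \<open>The ball \<open>val_ball v N\<close> is the fractional ideal of elements of valuation at least \<open>N\<close>.
  Valuations are integer valued, and their value at \<open>0\<close> is never inspected; morally it
  is infinite.\<close>

definition val_ball :: "('k::field \<Rightarrow> int) \<Rightarrow> int \<Rightarrow> 'k set" where
  "val_ball v N = {x. x = 0 \<or> N \<le> v x}"

definition integers_of :: "('k::field \<Rightarrow> int) \<Rightarrow> 'k set" where
  "integers_of v = val_ball v 0"

text \<open>A nonarchimedean local field is a field that is complete with respect to a discrete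
  valuation and has finite residue field; \<open>v\<close> is the normalised valuation.\<close>

locale nonarchimedean_local_field =
  fixes v :: "'k::field \<Rightarrow> int"
  assumes v_mult: "x \<noteq> 0 \<Longrightarrow> y \<noteq> 0 \<Longrightarrow> v (x * y) = v x + v y"
    and v_add: "x \<noteq> 0 \<Longrightarrow> y \<noteq> 0 \<Longrightarrow> x + y \<noteq> 0 \<Longrightarrow> min (v x) (v y) \<le> v (x + y)"
    and v_normalised: "\<exists>x. x \<noteq> 0 \<and> v x = 1"
    and complete: "\<And>s :: nat \<Rightarrow> 'k. (\<forall>N. \<exists>M. \<forall>i\<ge>M. \<forall>j\<ge>M. s i - s j \<in> val_ball v N) \<Longrightarrow>
      \<exists>l. \<forall>N. \<exists>M. \<forall>i\<ge>M. s i - l \<in> val_ball v N"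
    and finite_residue_field:
      "finite (integers_of v //
        {(x, y). x \<in> integers_of v \<and> y \<in> integers_of v \<and> x - y \<in> val_ball v 1})"

locale central_division_algebra = vector_space smul
  for smul :: "'k::field \<Rightarrow> 'b::division_ring \<Rightarrow> 'b" +
  assumes scale_mult_left: "smul a x * y = smul a (x * y)"
    and scale_mult_right: "x * smul a y = smul a (x * y)"
    and center_eq: "{z. \<forall>x. z * x = x * z} = range (\<lambda>a. smul a 1)"

text \<open>The operation \<open>*\<close> on the type \<open>'b^2^2\<close> is entrywise, so the matrix ring is set up as a
  record with the matrix product as its multiplication.\<close>

definition mat2_ring :: "('b::division_ring^2^2) ring" where
  "mat2_ring = \<lparr>carrier = UNIV, mult = (**), one = mat 1, zero = 0, add = (+)\<rparr>"

definition mat2_scale :: "('k \<Rightarrow> 'b \<Rightarrow> 'b) \<Rightarrow> 'k \<Rightarrow> 'b^2^2 \<Rightarrow> 'b^2^2" where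
  "mat2_scale smul a A = (\<chi> i j. smul a (A $ i $ j))"

lemma ring_mat2_ring: "ring (mat2_ring :: ('b::division_ring^2^2) ring)"
proof (rule ringI)
  show "abelian_group (mat2_ring :: ('b^2^2) ring)"
  proof (rule abelian_groupI)
    fix x :: "'b^2^2"
    show "\<exists>y\<in>carrier mat2_ring. y \<oplus>\<^bsub>mat2_ring\<^esub> x = \<zero>\<^bsub>mat2_ring\<^esub>"
      by (rule bexI[of _ "- x"]) (auto simp: mat2_ring_def)
  qed (auto simp: mat2_ring_def algebra_simps)
  show "monoid (mat2_ring :: ('b^2^2) ring)"
    by (rule monoidI) (auto simp: mat2_ring_def matrix_mul_assoc)
qed (auto simp: mat2_ring_def vec_eq_iff matrix_matrix_mult_def sum.distrib algebra_simps)

lemma (in central_division_algebra) vector_space_mat2_scale: "vector_space (mat2_scale smul)"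
  by unfold_locales
     (auto simp: mat2_scale_def vec_eq_iff scale_right_distrib scale_left_distrib)

text \<open>An order is a unital subring that is a full lattice: finitely generated over the ring of
  integers and spanning the algebra over the field.\<close>

definition is_order :: "('k::field \<Rightarrow> int) \<Rightarrow> ('k \<Rightarrow> 'b::division_ring \<Rightarrow> 'b) \<Rightarrow> ('b^2^2) set \<Rightarrow> bool"
  where
  "is_order v smul H \<longleftrightarrow>
     subring H mat2_ring \<and>
     (\<exists>F. finite F \<and> H = {\<Sum>A\<in>F. mat2_scale smul (c A) A | c. \<forall>A\<in>F. c A \<in> integers_of v}) \<and>
     module.span (mat2_scale smul) H = UNIV"

definition is_maximal_order ::
  "('k::field \<Rightarrow> int) \<Rightarrow> ('k \<Rightarrow> 'b::division_ring \<Rightarrow> 'b) \<Rightarrow> ('b^2^2) set \<Rightarrow> bool" where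
  "is_maximal_order v smul D \<longleftrightarrow>
     is_order v smul D \<and> (\<forall>D'. is_order v smul D' \<and> D \<subseteq> D' \<longrightarrow> D' = D)"

definition ring_center :: "('a, 'm) ring_scheme \<Rightarrow> 'a set" where
  "ring_center R = {z \<in> carrier R. \<forall>y\<in>carrier R. z \<otimes>\<^bsub>R\<^esub> y = y \<otimes>\<^bsub>R\<^esub> z}"

abbreviation mat2_subring :: "('b::division_ring^2^2) set \<Rightarrow> ('b^2^2) ring" where
  "mat2_subring D \<equiv> mat2_ring\<lparr>carrier := D\<rparr>"

text \<open>The predicate \<open>maximalideal\<close> is about two-sided ideals; a maximal order has exactly one such.\<close>

definition max_ideal :: "('b::division_ring^2^2) set \<Rightarrow> ('b^2^2) set" where
  "max_ideal D = (THE M. maximalideal M (mat2_subring D))"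

definition max_ideal_sq :: "('b::division_ring^2^2) set \<Rightarrow> ('b^2^2) set" where
  "max_ideal_sq D = ideal_prod (mat2_subring D) (max_ideal D) (max_ideal D)"

text \<open>The order \<open>D\<^sup>[\<^sup>2\<^sup>]\<close>: the preimage in \<open>D\<close> of the center of \<open>D / M\<^sup>2\<close>.\<close>

definition order_sq :: "('b::division_ring^2^2) set \<Rightarrow> ('b^2^2) set" where
  "order_sq D =
     {x \<in> D. max_ideal_sq D +>\<^bsub>mat2_subring D\<^esub> x
              \<in> ring_center (mat2_subring D Quot max_ideal_sq D)}"

end

theory Submission
  imports Defs "HOL-Analysis.Cartesian_Space" "HOL-Computational_Algebra.Primes"
    "Jordan_Normal_Form.Determinant"
begin

text \<open>Let \<open>B\<close> have valuation ring \<open>O\<close>, maximal ideal \<open>P\<close> and uniformiser \<open>\<pi>\<close>. Every maximal order of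
  \<open>M\<^sub>2(B)\<close> is a conjugate \<open>g M\<^sub>2(O) g\<^sup>-\<^sup>1\<close>, the stabiliser of the lattice \<open>g O\<^sup>2\<close>. By the Cartan and Iwasawa
  decompositions there is, for any three lattices, a basis of \<open>B\<^sup>2\<close> in which the scalar matrices over \<open>O\<close>
  stabilise all three, so an intersection of three maximal orders contains a copy of \<open>O\<close>. If this
  copy lay in \<open>D\<^sup>[\<^sup>2\<^sup>]\<close>, which is commutative modulo \<open>M\<^sub>D\<^sup>2\<close>, then \<open>O/P\<^sup>2\<close> would be commutative, and this
  forces \<open>B\<close> to be commutative. Conversely, a matrix over \<open>O/P\<^sup>2\<close> that preserves the submodule
  generated by \<open>(1, x)\<close> for all \<open>x\<close> and the one generated by \<open>(0, 1)\<close> is a central scalar, which writes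
  \<open>D\<^sup>[\<^sup>2\<^sup>]\<close> as an intersection of finitely many maximal orders.

  The valuation of \<open>B\<close> is a multiple of \<open>x \<mapsto> v (det (y \<mapsto> x y))\<close>. By compactness of the unit sphere of
  \<open>B\<close> this function differs by a bounded amount from a multiple of the coordinatewise valuation; it is
  ultrametric because the powers of \<open>1 + x\<close> stay bounded when those of \<open>x\<close> do.\<close>

section \<open>Discretely valued division rings\<close>

locale valuation =
  fixes w :: "'b::division_ring \<Rightarrow> int"
  assumes w_mult: "x \<noteq> 0 \<Longrightarrow> y \<noteq> 0 \<Longrightarrow> w (x * y) = w x + w y"
    and w_add: "x \<noteq> 0 \<Longrightarrow> y \<noteq> 0 \<Longrightarrow> x + y \<noteq> 0 \<Longrightarrow> min (w x) (w y) \<le> w (x + y)"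
begin

text \<open>The fractional ideals \<open>P^j\<close>: \<open>I 0\<close> is the valuation ring
  \<open>O\<close> and \<open>I 1\<close> its maximal ideal \<open>P\<close>. As \<open>w\<close> is
  integer valued, 0 is put in by hand.\<close>

definition I :: "int \<Rightarrow> 'b set" where
  "I j = {x. x = 0 \<or> j \<le> w x}"

lemma w_one [simp]: "w 1 = 0"
  using w_mult[of 1 1] by simp

lemma w_inverse: "x \<noteq> 0 \<Longrightarrow> w (inverse x) = - w x"
  using w_mult[of x "inverse x"] by simp

lemma w_minus [simp]: "w (- x) = w x"
proof (cases "x = 0")
  case False
  have "w (- 1) + w (- 1) = 0"
    using w_mult[of "-1" "-1"] by simp
  then show ?thesis
    using w_mult[of "- 1" x] False by simp
qed simp

lemma w_power: "x \<noteq> 0 \<Longrightarrow> w (x ^ n) = int n * w x"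
  by (induction n) (simp_all add: w_mult algebra_simps)

lemma I_zero [simp, intro]: "0 \<in> I j"
  by (simp add: I_def)

lemma I_one [simp, intro]: "1 \<in> I 0"
  by (simp add: I_def)

lemma I_mono: "x \<in> I j \<Longrightarrow> i \<le> j \<Longrightarrow> x \<in> I i"
  by (auto simp: I_def)

lemma I_minus [simp]: "- x \<in> I j \<longleftrightarrow> x \<in> I j"
  by (simp add: I_def)

lemma I_add: "x \<in> I j \<Longrightarrow> y \<in> I j \<Longrightarrow> x + y \<in> I j"
  using w_add[of x y] by (fastforce simp: I_def)

lemma I_diff: "x \<in> I j \<Longrightarrow> y \<in> I j \<Longrightarrow> x - y \<in> I j"
  using I_add[of x j "- y"] by simp

lemma I_diff_commute: "x - y \<in> I j \<longleftrightarrow> y - x \<in> I j"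
  using I_minus[of "x - y" j] by simp

lemma I_mult: "x \<in> I i \<Longrightarrow> y \<in> I j \<Longrightarrow> x * y \<in> I (i + j)"
  by (cases "x = 0"; cases "y = 0") (auto simp: I_def w_mult)

lemma I_mult_integral_left: "x \<in> I 0 \<Longrightarrow> y \<in> I j \<Longrightarrow> x * y \<in> I j"
  using I_mult[of x 0 y j] by simp

lemma I_mult_integral_right: "x \<in> I j \<Longrightarrow> y \<in> I 0 \<Longrightarrow> x * y \<in> I j"
  using I_mult[of x j y 0] by simp

lemma I_mult_iff: "x \<noteq> 0 \<Longrightarrow> x * y \<in> I j \<longleftrightarrow> y \<in> I (j - w x)"
  by (cases "y = 0") (auto simp: I_def w_mult)

lemma I_mult_iff': "y \<noteq> 0 \<Longrightarrow> x * y \<in> I j \<longleftrightarrow> x \<in> I (j - w y)"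
  by (cases "x = 0") (auto simp: I_def w_mult)

lemma I_power: "x \<in> I j \<Longrightarrow> x ^ n \<in> I (int n * j)"
  by (cases "x = 0"; cases "n = 0") (auto simp: I_def w_power mult_left_mono)

lemma I_power_integral: "x \<in> I 0 \<Longrightarrow> x ^ n \<in> I 0"
  using I_power[of x 0 n] by simp

lemma I_sum: "(\<And>a. a \<in> A \<Longrightarrow> f a \<in> I j) \<Longrightarrow> sum f A \<in> I j"
  by (induction A rule: infinite_finite_induct) (auto intro: I_add)

text \<open>The value group is commutative, so conjugation preserves values and each
  \<open>P^j\<close> is stable under it.\<close>

lemma I_prod_conj: "q \<noteq> 0 \<Longrightarrow> inverse q * x * q \<in> I j \<longleftrightarrow> x \<in> I j"
  by (simp add: I_mult_iff I_mult_iff' mult.assoc w_inverse)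

lemma of_nat_I [simp, intro]: "of_nat n \<in> I 0"
  by (induction n) (auto intro: I_add)

lemma one_notin_I: "0 < j \<Longrightarrow> 1 \<notin> I j"
  by (simp add: I_def)

lemma I_all_imp_zero: "(\<And>j. 0 \<le> j \<Longrightarrow> x \<in> I j) \<Longrightarrow> x = 0"
proof (rule ccontr)
  assume *: "\<And>j. 0 \<le> j \<Longrightarrow> x \<in> I j" and "x \<noteq> 0"
  then show False using *[of "\<bar>w x\<bar> + 1"] by (auto simp: I_def)
qed

text \<open>Dividing \<open>m * w x \<ge> m * j - C\<close> by a large \<open>m\<close> removes the
  constant. Integrality can thus be read off from powers that are controlled only up to a fixed
  error, as after a change of basis.\<close>

lemma w_ge_if_powers_ge:
  assumes "x \<noteq> 0" and "\<And>m. x ^ m \<in> I (int m * j - C)"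
  shows "j \<le> w x"
proof (rule ccontr)
  assume "\<not> j \<le> w x"
  \<comment> \<open>Each power loses at least 1 against \<open>j\<close>, so the exponent
    \<open>\<bar>C\<bar> + 1\<close> already beats the constant.\<close>
  then have "int (nat (\<bar>C\<bar> + 1)) * w x \<le> int (nat (\<bar>C\<bar> + 1)) * (j - 1)"
    by (intro mult_left_mono) auto
  also have "\<dots> = int (nat (\<bar>C\<bar> + 1)) * j - \<bar>C\<bar> - 1"
    by (simp add: algebra_simps)
  finally have "int (nat (\<bar>C\<bar> + 1)) * w x < int (nat (\<bar>C\<bar> + 1)) * j - C"
    by linarith
  then show False
    using assms(2)[of "nat (\<bar>C\<bar> + 1)"] assms(1)
    by (simp add: I_def w_power)
qed

end

text \<open>Only 1 and \<open>x\<close> occur, and they commute, so the binomial theorem holds in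
  every ring; the proof is Pascal's rule after an index shift.\<close>

lemma one_plus_power:
  fixes x :: "'a::ring_1"
  shows "(1 + x) ^ m = (\<Sum>i\<le>m. of_nat (m choose i) * x ^ i)"
proof (induction m)
  case (Suc m)
  have "(1 + x) ^ Suc m = (\<Sum>i\<le>m. of_nat (m choose i) * x ^ i) + 
      (\<Sum>i\<le>m. of_nat (m choose i) * x ^ Suc i)"
    using mult_of_nat_commute[of _ x]
    by (simp add: Suc distrib_right sum_distrib_left sum.distrib flip: mult.assoc)
  also have "(\<Sum>i\<le>m. of_nat (m choose i) * x ^ i) = 
      (\<Sum>i\<le>Suc m. of_nat (m choose i) * x ^ i)"
    by (simp add: binomial_eq_0)
  also have "\<dots> = 1 + (\<Sum>i\<le>m. of_nat (m choose Suc i) * x ^ Suc i)"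
    by (subst sum.atMost_Suc_shift) simp
  also have "1 + (\<Sum>i\<le>m. of_nat (m choose Suc i) * x ^ Suc i) +
      (\<Sum>i\<le>m. of_nat (m choose i) * x ^ Suc i) =
      1 + (\<Sum>i\<le>m. of_nat (Suc m choose Suc i) * x ^ Suc i)"
    by (simp add: sum.distrib[symmetric] distrib_right add_ac)
  also have "\<dots> = (\<Sum>i\<le>Suc m. of_nat (Suc m choose i) * x ^ i)"
    by (subst sum.atMost_Suc_shift) simp
  finally show ?case .
qed simp

text \<open>Compactness of \<open>O\<close> enters as finiteness of the quotients
  \<open>O/P^j\<close>: \<open>j = 1\<close> gives the finite residue ring, \<open>j = 2\<close> the
  representatives that index a finite family of lattices.\<close>

locale discretely_valued_division_ring = valuation w for w :: "'b::division_ring \<Rightarrow> int" +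
  assumes uniformiser: "\<exists>p. p \<noteq> 0 \<and> w p = 1"
    and finite_quotients: "\<exists>R. finite R \<and> R \<subseteq> I 0 \<and> (\<forall>x\<in>I 0. \<exists>r\<in>R. x - r \<in> I j)"
begin

section \<open>Residue characteristic and units modulo the maximal ideal\<close>

lemma residue_pigeonhole:
  fixes f :: "nat \<Rightarrow> 'b"
  assumes "\<And>i. f i \<in> I 0"
  obtains i j where "i < j" "f i - f j \<in> I 1"
proof -
  obtain R where R: "finite R" "\<And>x. x \<in> I 0 \<Longrightarrow> \<exists>r\<in>R. x - r \<in> I 1"
    using finite_quotients[of 1] by metis
  then have "\<forall>i. \<exists>r\<in>R. f i - r \<in> I 1" using assms by blast
  then obtain g where g: "\<And>i. g i \<in> R" "\<And>i. f i - g i \<in> I 1" by metis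
  have "finite (range g)" using R(1) g(1) by (meson finite_subset image_subsetI)
  then have "\<not> inj g" using finite_imageD infinite_UNIV_nat by blast
  then obtain i j where "i < j" "g i = g j"
    by (metis injI linorder_neqE_nat)
  then show thesis using that I_diff[OF g(2)[of i] g(2)[of j]] by simp
qed

text \<open>The natural numbers repeat modulo \<open>P\<close>, so some positive integer lies in
  \<open>P\<close>. The least one is prime because a product of integers lies in \<open>P\<close>
  only if a factor does.\<close>

lemma residue_char:
  obtains p :: nat where "prime p" "of_nat p \<in> I 1"
proof -
  obtain i j :: nat where ij: "i < j" "(of_nat i :: 'b) - of_nat j \<in> I 1"
    by (rule residue_pigeonhole[of of_nat]) auto
  then have "of_nat (j - i) \<in> I 1"
    using I_diff_commute[of "of_nat i" "of_nat j" 1] by (simp add: of_nat_diff)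
  define p where "p = (LEAST p::nat. 0 < p \<and> of_nat p \<in> I 1)"
  have p: "0 < p" "of_nat p \<in> I 1"
    using LeastI[of "\<lambda>p::nat. 0 < p \<and> of_nat p \<in> I 1" "j - i"] ij \<open>of_nat (j - i) \<in> I 1\<close>
    by (auto simp: p_def)
  have least: "p \<le> q" if "0 < q" "of_nat q \<in> I 1" for q
    unfolding p_def using that by (intro Least_le) simp
  have "p \<noteq> 1" using p one_notin_I[of 1] by auto
  have "prime p"
  proof (rule ccontr)
    assume "\<not> prime p"
    then obtain a where a: "a dvd p" "a \<noteq> 1" "a \<noteq> p"
      using p(1) \<open>p \<noteq> 1\<close> by (auto simp: prime_nat_iff)
    then obtain b where b: "p = a * b" by (auto elim: dvdE)
    have "0 < a" "0 < b" "a < p" using a p(1) b dvd_imp_le[OF a(1)] by (auto intro: Nat.gr0I)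
    moreover have "b < p" using a b \<open>0 < a\<close> \<open>0 < b\<close> by simp
    ultimately have ab: "p = a * b" "a < p" "b < p" "0 < a" "0 < b" using b by auto
    have "of_nat a \<in> I 1 \<or> of_nat b \<in> I 1"
    proof (rule ccontr)
      assume *: "\<not> (of_nat a \<in> I 1 \<or> of_nat b \<in> I 1)"
      then have "(of_nat a :: 'b) \<noteq> 0" "(of_nat b :: 'b) \<noteq> 0" "w (of_nat a) = 0" "w (of_nat b) = 0"
        using of_nat_I[of a] of_nat_I[of b] by (auto simp: I_def)
      then show False using p(2) by (simp add: ab(1) I_def w_mult)
    qed
    then show False using least[of a] least[of b] ab by linarith
  qed
  then show thesis using that p by blast
qed

text \<open>Powers of a unit repeat in the finite residue ring, so some \<open>x ^ k\<close> is 1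
  modulo \<open>P\<close>. For the least \<open>k\<close> the residue characteristic
  \<open>p\<close> cannot divide \<open>k\<close>: Frobenius is injective, so
  \<open>x ^ (k / p)\<close> would already be 1 modulo \<open>P\<close>.\<close>

lemma unit_root_mod:
  assumes "x \<noteq> 0" "w x = 0"
  obtains k :: nat where "0 < k" "x ^ k - 1 \<in> I 1" "of_nat k \<notin> I 1"
proof -
  obtain p where p: "prime p" "of_nat p \<in> I 1" by (rule residue_char)
  obtain i j where ij: "i < j" "x ^ i - x ^ j \<in> I 1"
    using residue_pigeonhole[of "\<lambda>i. x ^ i"] I_power_integral[of x] assms by (auto simp: I_def)
  have "x ^ j = x ^ i * x ^ (j - i)" using ij by (simp flip: power_add)
  then have "x ^ j - x ^ i = x ^ i * (x ^ (j - i) - 1)" by (simp add: algebra_simps)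
  then have "x ^ (j - i) - 1 \<in> I 1"
    using ij(2) assms I_mult_iff[of "x ^ i" "x ^ (j - i) - 1" 1] I_diff_commute[of "x ^ i" "x ^ j" 1]
    by (simp add: w_power)
  define k where "k = (LEAST k::nat. 0 < k \<and> x ^ k - 1 \<in> I 1)"
  have k: "0 < k" "x ^ k - 1 \<in> I 1"
    using LeastI[of "\<lambda>k::nat. 0 < k \<and> x ^ k - 1 \<in> I 1" "j - i"] ij \<open>x ^ (j - i) - 1 \<in> I 1\<close>
    by (auto simp: k_def)
  have least: "k \<le> q" if "0 < q" "x ^ q - 1 \<in> I 1" for q
    unfolding k_def using that by (intro Least_le) simp
  have "\<not> p dvd k"
  proof
    assume "p dvd k"
    then obtain l where l: "k = l * p" by (metis dvd_def mult.commute)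
    define y where "y = x ^ l - 1"
    have y0: "y \<in> I 0" 
      unfolding y_def using assms by (intro I_diff I_power_integral I_one) (simp add: I_def)
    have "0 < p" using p(1) prime_gt_0_nat by blast
    \<comment> \<open>The inner binomial coefficients are divisible by \<open>p\<close>, so
      \<open>(1 + y) ^ p\<close> is \<open>1 + y ^ p\<close> modulo \<open>P\<close>; then
      \<open>y ^ p\<close>, and with it \<open>y\<close>, lies in \<open>P\<close>.\<close>
    have "x ^ k = (1 + y) ^ p" by (simp add: l power_mult y_def)
    also have "\<dots> = (\<Sum>i\<le>p. of_nat (p choose i) * y ^ i)" by (rule one_plus_power)
    also have "{..p} = insert 0 (insert p {0<..<p})" using \<open>0 < p\<close> by auto
    also have "(\<Sum>i\<in>insert 0 (insert p {0<..<p}). of_nat (p choose i) * y ^ i) = 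
      1 + (y ^ p + (\<Sum>i\<in>{0<..<p}. of_nat (p choose i) * y ^ i))"
      using \<open>0 < p\<close> by simp
    finally have eq: "y ^ p = (x ^ k - 1) - (\<Sum>i\<in>{0<..<p}. of_nat (p choose i) * y ^ i)"
      by simp
    have "of_nat (p choose i) * y ^ i \<in> I 1" if "i \<in> {0<..<p}" for i
    proof -
      have "p dvd (p choose i)" using that p(1) by (intro dvd_choose_prime) auto
      then obtain c where "p choose i = p * c" by (auto simp: dvd_def)
      then show ?thesis using p(2) y0 
        by (simp add: I_mult_integral_right I_power_integral mult.assoc I_mult_integral_left)
    qed
    then have "y ^ p \<in> I 1" unfolding eq by (intro I_diff[OF k(2)] I_sum)
    then have "y \<in> I 1" using \<open>0 < p\<close> y0 zero_less_mult_iff[of "int p" "w y"]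
      by (cases "y = 0") (auto simp: I_def w_power)
    moreover have "0 < l" "l < k" using l k(1) p(1) prime_gt_1_nat[OF p(1)] by auto
    ultimately show False using least[of l] by (simp add: y_def)
  qed
  \<comment> \<open>Bezout turns coprimality of \<open>k\<close> and \<open>p\<close> into a
    relation in \<open>B\<close>, which would put 1 into \<open>P\<close> if \<open>k\<close> lay
    there.\<close>
  then obtain a b where "int k * a + int p * b = 1"
    using p(1) by (metis bezout_int coprime_imp_gcd_eq_1 gcd_int_int_eq of_nat_1 prime_imp_coprime gcd.commute mult.commute)
  then have e: "(of_nat k :: 'b) * of_int a + of_nat p * of_int b = 1"
    by (metis of_int_1 of_int_add of_int_mult of_int_of_nat_eq)
  have oi: "of_int c \<in> I 0" for c :: int
    by (cases c) (simp_all add: I_diff del: of_nat_Suc)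
  have "of_nat k \<notin> I 1"
  proof
    assume "of_nat k \<in> I 1"
    then have "(of_nat k :: 'b) * of_int a + of_nat p * of_int b \<in> I 1"
      using p(2) oi by (intro I_add I_mult_integral_right)
    then show False using e one_notin_I[of 1] by simp
  qed
  then show thesis using that k by blast
qed


section \<open>Commutators along the filtration by powers of \<open>P\<close>\<close>

text \<open>The hypothesis makes a uniformiser commute with \<open>O\<close> modulo
  \<open>P^2\<close>, so left and right multiplication by \<open>a\<close> agree on
  \<open>P^j/P^(j+1)\<close>: write \<open>z\<close> as \<open>p ^ j * u\<close> with
  \<open>u\<close> integral.\<close>

lemma commutes_mod_I:
  assumes O: "\<And>x y. x \<in> I 0 \<Longrightarrow> y \<in> I 0 \<Longrightarrow> x * y - y * x \<in> I 2"
    and a: "a \<in> I 0" and z: "z \<in> I (int j)"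
  shows "a * z - z * a \<in> I (int j + 1)"
proof -
  obtain p where p: "p \<noteq> 0" "w p = 1" using uniformiser by blast
  have p0: "p \<in> I 0" and pI: "p \<in> I 1" using p by (auto simp: I_def)
  have pw: "a * p ^ m - p ^ m * a \<in> I (int m + 1)" for m
  proof (induction m)
    case (Suc m)
    \<comment> \<open>The Leibniz rule: the commutator with one factor \<open>p\<close> has value at
      least 2, one more than the factor it replaces.\<close>
    have "a * p ^ Suc m - p ^ Suc m * a = (a * p - p * a) * p ^ m + p * (a * p ^ m - p ^ m * a)"
      by (simp add: algebra_simps)
    moreover have "(a * p - p * a) * p ^ m \<in> I (2 + int m)"
      using O[OF a p0] I_power[OF pI, of m] by (intro I_mult) auto
    moreover have "p * (a * p ^ m - p ^ m * a) \<in> I (1 + (int m + 1))"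
      using Suc pI by (intro I_mult)
    ultimately show ?case by (auto intro!: I_add simp: add_ac)
  qed simp
  define u where "u = inverse (p ^ j) * z"
  have zu: "z = p ^ j * u" using p by (simp add: u_def mult.assoc[symmetric])
  have u: "u \<in> I 0" using z p by (simp add: zu I_mult_iff w_power)
  have "a * z - z * a = (a * p ^ j - p ^ j * a) * u + p ^ j * (a * u - u * a)"
    by (simp add: zu algebra_simps)
  moreover have "(a * p ^ j - p ^ j * a) * u \<in> I (int j + 1)"
    using pw u by (intro I_mult_integral_right)
  moreover have "p ^ j * (a * u - u * a) \<in> I (int j + 2)"
    using I_power[OF pI, of j] O[OF a u] by (intro I_mult) auto
  then have "p ^ j * (a * u - u * a) \<in> I (int j + 1)"
    by (rule I_mono) simp
  ultimately show ?thesis by (auto intro: I_add)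
qed

text \<open>The Leibniz rule expands \<open>[a ^ (m + 1), b]\<close> into \<open>m + 1\<close> terms
  \<open>a ^ i * [a, b] * a ^ (m - i)\<close>. Since \<open>[a, b]\<close> lies in
  \<open>I k\<close>, powers of \<open>a\<close> move past it modulo \<open>I (k + 1)\<close>, and
  the terms become equal.\<close>

lemma commutator_power:
  assumes O: "\<And>x y. x \<in> I 0 \<Longrightarrow> y \<in> I 0 \<Longrightarrow> x * y - y * x \<in> I 2"
    and a: "a \<in> I 0" and c: "a * b - b * a \<in> I (int k)"
  shows "(a ^ Suc m * b - b * a ^ Suc m) - of_nat (Suc m) * a ^ m * (a * b - b * a) \<in> I (int k + 1)"
proof (induction m)
  case (Suc m)
  let ?c = "a * b - b * a"
  have *: "a * (of_nat (Suc m) * a ^ m * ?c) = of_nat (Suc m) * a ^ Suc m * ?c"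
    using mult_of_nat_commute[of "Suc m" a] by (simp only: mult.assoc[symmetric] power_Suc)
  have "(a ^ Suc (Suc m) * b - b * a ^ Suc (Suc m)) - of_nat (Suc (Suc m)) * a ^ Suc m * ?c =
    a * (a ^ Suc m * b - b * a ^ Suc m) - of_nat (Suc m) * a ^ Suc m * ?c
    - (a ^ Suc m * ?c - ?c * a ^ Suc m)"
    unfolding of_nat_Suc[of "Suc m"] power_Suc[of a "Suc m"]
    by (simp only: algebra_simps mult_1_left mult_1_right)
  also have "\<dots> = a * ((a ^ Suc m * b - b * a ^ Suc m) - of_nat (Suc m) * a ^ m * ?c)
    - (a ^ Suc m * ?c - ?c * a ^ Suc m)"
    by (simp only: right_diff_distrib[of a "_ - _" "_ * _ * _"] *)
  finally show ?case
    using Suc a commutes_mod_I[OF O I_power_integral[OF a] c, of "Suc m"]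
    by (simp only: I_diff I_mult_integral_left)
qed simp

text \<open>If all commutators of integers lie in \<open>I k\<close>, then modulo \<open>I (k + 1)\<close> the
  commutator is a biderivation into a symmetric bimodule over the residue field. Units are roots of
  unity of order prime to the residue characteristic modulo \<open>I 1\<close>, so such a biderivation is
  determined by its values on \<open>I 1\<close>, where it vanishes.\<close>

lemma commutators_improve:
  assumes O: "\<And>x y. x \<in> I 0 \<Longrightarrow> y \<in> I 0 \<Longrightarrow> x * y - y * x \<in> I 2"
    and Ok: "\<And>x y. x \<in> I 0 \<Longrightarrow> y \<in> I 0 \<Longrightarrow> x * y - y * x \<in> I (int k)"
    and x: "x \<in> I 0" and y: "y \<in> I 0"
  shows "x * y - y * x \<in> I (int k + 1)"
proof -
  obtain p where p: "p \<noteq> 0" "w p = 1" using uniformiser by blast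
  have p0: "p \<in> I 0" and pI: "p \<in> I 1" using p by (auto simp: I_def)
  \<comment> \<open>One uniformiser is pulled out on the left, so each remaining commutator, lying
    in \<open>I k\<close> by assumption, gains 1.\<close>
  have both: "a * b - b * a \<in> I (int k + 1)" if a: "a \<in> I 1" and b: "b \<in> I 1" for a b
  proof -
    define a' where "a' = inverse p * a"
    define b' where "b' = inverse p * b"
    have ab: "a = p * a'" "b = p * b'" using p by (auto simp: a'_def b'_def mult.assoc[symmetric])
    have a': "a' \<in> I 0" and b': "b' \<in> I 0" using a b p by (auto simp: ab I_mult_iff)
    have "a * b - b * a = p * (a' * b - b * a') + p * (p * b' - b' * p) * a'"
      by (simp add: ab algebra_simps)
    moreover have "p * (a' * b - b * a') \<in> I (1 + int k)"
      using pI b by (intro I_mult Ok a') (auto elim: I_mono)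
    moreover have "p * (p * b' - b' * p) * a' \<in> I (1 + int k)"
      using pI by (intro I_mult_integral_right[OF _ a'] I_mult Ok b' p0)
    ultimately show ?thesis by (auto intro: I_add simp: add.commute)
  qed
  \<comment> \<open>A unit \<open>a\<close> is traded for \<open>a ^ m - 1\<close> in
    \<open>P\<close>: the commutator of \<open>a ^ m\<close> with \<open>b\<close> is
    \<open>m * a ^ (m - 1) * [a, b]\<close> up to \<open>I (k + 1)\<close>, and
    \<open>m * a ^ (m - 1)\<close> is a unit.\<close>
  have reduce: "\<exists>a'\<in>I 1. \<forall>b\<in>I 0. a' * b - b * a' \<in> I (int k + 1) \<longrightarrow> a * b - b * a \<in> I (int k + 1)"
    if a: "a \<in> I 0" for a
  proof (cases "a \<in> I 1")
    case True
    then show ?thesis by blast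
  next
    case False
    then have a0: "a \<noteq> 0" "w a = 0" using a by (auto simp: I_def)
    then obtain m where m: "0 < m" "a ^ m - 1 \<in> I 1" "of_nat m \<notin> I 1" by (rule unit_root_mod)
    then obtain l where l: "m = Suc l" by (cases m) auto
    have m0: "(of_nat m :: 'b) \<noteq> 0" "w (of_nat m) = 0"
      using m(3) of_nat_I[of m] by (auto simp: I_def)
    show ?thesis
    proof (intro bexI[of _ "a ^ m - 1"] ballI impI)
      fix b assume b: "b \<in> I 0" "(a ^ m - 1) * b - b * (a ^ m - 1) \<in> I (int k + 1)"
      then have "a ^ Suc l * b - b * a ^ Suc l \<in> I (int k + 1)"
        by (simp add: l algebra_simps)
      from I_diff[OF this commutator_power[OF O a Ok[OF a b(1)], of l]]
      have "of_nat m * a ^ l * (a * b - b * a) \<in> I (int k + 1)"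
        by (simp add: l)
      then show "a * b - b * a \<in> I (int k + 1)"
        using m0 a0 by (simp add: I_mult_iff mult.assoc w_power)
    qed (use m in auto)
  qed
  obtain x' where x': "x' \<in> I 1"
    and x'_imp: "\<And>b. b \<in> I 0 \<Longrightarrow> x' * b - b * x' \<in> I (int k + 1) \<Longrightarrow> x * b - b * x \<in> I (int k + 1)"
    using reduce[OF x] by blast
  obtain y' where y': "y' \<in> I 1"
    and y'_imp: "\<And>b. b \<in> I 0 \<Longrightarrow> y' * b - b * y' \<in> I (int k + 1) \<Longrightarrow> y * b - b * y \<in> I (int k + 1)"
    using reduce[OF y] by blast
  have "x' \<in> I 0" using x' by (auto elim: I_mono)
  \<comment> \<open>The reduction acts on the left entry: it is applied to \<open>y\<close> against
    \<open>x'\<close>, the commutator changes sign, and it is applied to \<open>x\<close> against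
    \<open>y\<close>.\<close>
  have "y * x' - x' * y \<in> I (int k + 1)"
    by (rule y'_imp[OF \<open>x' \<in> I 0\<close> both[OF y' x']])
  then show ?thesis
    by (intro x'_imp y) (simp only: I_diff_commute[of "y * x'"])
qed

text \<open>Repeated improvement puts the commutators of integers into every \<open>I j\<close>, so
  they vanish. This extends to \<open>B\<close> because each element is integral or has an integral
  inverse.\<close>

theorem commutative_if_commutative_mod_square:
  fixes x y :: 'b
  assumes O: "\<And>x y. x \<in> I 0 \<Longrightarrow> y \<in> I 0 \<Longrightarrow> x * y - y * x \<in> I 2"
  shows "x * y = y * x"
proof -
  have all: "a * b - b * a \<in> I (2 + int k)" if "a \<in> I 0" "b \<in> I 0" for a b k
    using that
  proof (induction k arbitrary: a b)
    case (Suc k)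
    have "a * b - b * a \<in> I (int (2 + k) + 1)"
      using Suc by (intro commutators_improve[OF O]) simp_all
    then show ?case by (simp add: algebra_simps)
  qed (use O in simp)
  have comm: "a * b = b * a" if "a \<in> I 0" "b \<in> I 0" for a b
  proof -
    have "a * b - b * a = 0"
    proof (rule I_all_imp_zero)
      fix j :: int assume "0 \<le> j"
      then show "a * b - b * a \<in> I j" using all[OF that, of "nat j"] by (auto elim: I_mono)
    qed
    then show ?thesis by simp
  qed
  have inv: "inverse a * b = b * inverse a" if "a * b = b * a" "a \<noteq> 0" for a b :: 'b
    using that by (metis mult.assoc mult_1_left mult_1_right left_inverse right_inverse)
  have comm': "a * b = b * a" if "a \<in> I 0" for a b
  proof (cases "b \<in> I 0")
    case False
    then have "b \<noteq> 0" "inverse b \<in> I 0" by (auto simp: I_def w_inverse)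
    then show ?thesis using inv[of "inverse b" a] comm[OF that] by simp
  qed (use comm that in blast)
  show ?thesis
  proof (cases "x \<in> I 0")
    case False
    then have "x \<noteq> 0" "inverse x \<in> I 0" by (auto simp: I_def w_inverse)
    then show ?thesis using inv[of "inverse x" y] comm' by simp
  qed (use comm' in blast)
qed

end

section \<open>Extending the valuation to a division algebra\<close>

lemma (in valuation) I_signof: "signof p \<in> I 0"
  using I_minus[of 1 0] by (auto simp: sign_def)

section \<open>Finitely generated modules over the integers of \<open>K\<close>\<close>

text \<open>For finite \<open>F\<close> the generated \<open>O_K\<close>-module, in the shape used
  by \<open>is_order\<close>, but available for \<open>B\<close> as well as for matrices.\<close>

definition int_span :: "('k::field \<Rightarrow> int) \<Rightarrow> ('k \<Rightarrow> 'a::comm_monoid_add \<Rightarrow> 'a) \<Rightarrow> 'a set \<Rightarrow> 'a set" where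
  "int_span v sc F = {\<Sum>x\<in>F. sc (c x) x | c. \<forall>x\<in>F. c x \<in> integers_of v}"

sublocale nonarchimedean_local_field \<subseteq> K: valuation v
  by unfold_locales (auto intro: v_mult v_add)

context nonarchimedean_local_field
begin

lemma val_ball_eq: "val_ball v = K.I"
  by (auto simp: fun_eq_iff val_ball_def K.I_def)

lemma integers_of_eq: "integers_of v = K.I 0"
  by (simp add: integers_of_def val_ball_eq)

lemma exists_valuation: "\<exists>a. a \<noteq> 0 \<and> v a = j"
proof -
  obtain t where t: "t \<noteq> 0" "v t = 1" using v_normalised by blast
  show ?thesis
  proof (cases "0 \<le> j")
    case True
    then show ?thesis using t by (intro exI[of _ "t ^ nat j"]) (simp add: K.w_power)
  next
    case False
    then show ?thesis
      using t by (intro exI[of _ "inverse (t ^ nat (- j))"]) (simp add: K.w_power K.w_inverse)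
  qed
qed

lemma residue_cover: "\<exists>R. finite R \<and> (\<forall>a\<in>K.I 0. \<exists>r\<in>R. a - r \<in> K.I 1)"
proof -
  let ?r = "{(x, y). x \<in> integers_of v \<and> y \<in> integers_of v \<and> x - y \<in> val_ball v 1}"
  let ?R = "(\<lambda>X. SOME x. x \<in> X) ` (integers_of v // ?r)"
  have "\<exists>r\<in>?R. a - r \<in> K.I 1" if a: "a \<in> K.I 0" for a
  proof (intro bexI)
    have "a \<in> ?r `` {a}" using a by (simp add: integers_of_eq val_ball_eq)
    then have "(SOME x. x \<in> ?r `` {a}) \<in> ?r `` {a}" by (rule someI)
    moreover have "a - b \<in> K.I 1" if "b \<in> ?r `` {a}" for b using that by (simp add: val_ball_eq)
    ultimately show "a - (SOME x. x \<in> ?r `` {a}) \<in> K.I 1" by blast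
    show "(SOME x. x \<in> ?r `` {a}) \<in> ?R"
      using a by (intro imageI quotientI) (simp add: integers_of_eq)
  qed
  then show ?thesis using finite_residue_field by (intro exI[of _ ?R]) blast
qed

lemma I_prod: "(\<And>i. i \<in> A \<Longrightarrow> f i \<in> K.I j) \<Longrightarrow> prod f A \<in> K.I (int (card A) * j)"
proof (induction A rule: infinite_finite_induct)
  case (insert x F)
  then have "f x * prod f F \<in> K.I (j + int (card F) * j)" by (intro K.I_mult) auto
  then show ?case using insert by (simp add: algebra_simps)
qed auto

text \<open>Every term of the Leibniz formula is, up to sign, a product of \<open>n\<close>
  entries.\<close>

lemma det_in_I:
  assumes "A \<in> carrier_mat n n" and "\<And>i k. i < n \<Longrightarrow> k < n \<Longrightarrow> A $$ (i, k) \<in> K.I j"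
  shows "Determinant.det A \<in> K.I (int n * j)"
proof -
  have "(\<Prod>i = 0..<n. A $$ (i, p i)) \<in> K.I (int n * j)" if "p permutes {0..<n}" for p
    using I_prod[of "{0..<n}" "\<lambda>i. A $$ (i, p i)" j] assms(2) permutes_in_image[OF that] by simp
  then show ?thesis
    unfolding det_def'[OF assms(1)]
    by (intro K.I_sum K.I_mult_integral_left K.I_signof) auto
qed

end

locale integral_vector_space = nonarchimedean_local_field v + vector_space sc
  for v :: "'k::field \<Rightarrow> int" and sc :: "'k \<Rightarrow> 'a::ab_group_add \<Rightarrow> 'a"
begin

lemma int_span_add: "x \<in> int_span v sc F \<Longrightarrow> y \<in> int_span v sc F \<Longrightarrow> x + y \<in> int_span v sc F"
proof -
  assume "x \<in> int_span v sc F" "y \<in> int_span v sc F"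
  then obtain c d where "x = (\<Sum>z\<in>F. sc (c z) z)" "y = (\<Sum>z\<in>F. sc (d z) z)"
    "\<forall>z\<in>F. c z \<in> integers_of v" "\<forall>z\<in>F. d z \<in> integers_of v"
    by (auto simp: int_span_def)
  then show ?thesis
    unfolding int_span_def
    by (auto intro!: exI[of _ "\<lambda>z. c z + d z"] simp: scale_left_distrib sum.distrib integers_of_eq K.I_add)
qed

lemma int_span_scale:
  assumes "a \<in> K.I 0" "finite F" "x \<in> F"
  shows "sc a x \<in> int_span v sc F"
  unfolding int_span_def
  using assms by (auto intro!: exI[of _ "\<lambda>z. if z = x then a else 0"]
      simp: if_distribR if_distrib[of "\<lambda>a. sc a _"] integers_of_eq sum.delta cong: if_cong)

lemma int_span_base: "finite F \<Longrightarrow> x \<in> F \<Longrightarrow> x \<in> int_span v sc F"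
  using int_span_scale[of 1 F x] by simp

lemma int_span_sum: "(\<And>i. i \<in> A \<Longrightarrow> f i \<in> int_span v sc F) \<Longrightarrow> sum f A \<in> int_span v sc F"
proof (induction A rule: infinite_finite_induct)
  case (infinite A)
  then show ?case by (auto simp: int_span_def integers_of_eq intro!: exI[of _ "\<lambda>_. 0"])
next
  case empty
  then show ?case by (auto simp: int_span_def integers_of_eq intro!: exI[of _ "\<lambda>_. 0"])
qed (auto intro: int_span_add)

lemma int_span_subset:
  assumes "F \<subseteq> M" "0 \<in> M" "\<And>x y. x \<in> M \<Longrightarrow> y \<in> M \<Longrightarrow> x + y \<in> M"
    "\<And>a x. a \<in> K.I 0 \<Longrightarrow> x \<in> M \<Longrightarrow> sc a x \<in> M"
  shows "int_span v sc F \<subseteq> M"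
proof
  fix x assume "x \<in> int_span v sc F"
  then obtain c where c: "x = (\<Sum>z\<in>F. sc (c z) z)" "\<forall>z\<in>F. c z \<in> K.I 0"
    by (auto simp: int_span_def integers_of_eq)
  have "(\<Sum>z\<in>G. sc (c z) z) \<in> M" if "G \<subseteq> F" for G
    using that
  proof (induction G rule: infinite_finite_induct)
    case (insert y G)
    then show ?case using c assms by (simp add: subset_iff)
  qed (use assms in auto)
  then show "x \<in> M" using c by blast
qed

end

section \<open>Coordinate lattices and compactness\<close>

locale division_algebra_over_local_field =
  nonarchimedean_local_field v + central_division_algebra smul
  for v :: "'k::field \<Rightarrow> int" and smul :: "'k \<Rightarrow> 'b::division_ring \<Rightarrow> 'b" +
  fixes E :: "'b set"
  assumes finite_E: "finite E" and independent_E: "independent E" and span_E: "span E = UNIV"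
begin

sublocale integral_vector_space v smul ..

definition coord :: "'b \<Rightarrow> 'b \<Rightarrow> 'k" where
  "coord = representation E"

lemma coord_add: "coord (x + y) e = coord x e + coord y e"
  by (simp add: coord_def representation_add independent_E span_E)

lemma coord_diff: "coord (x - y) e = coord x e - coord y e"
  by (simp add: coord_def representation_diff independent_E span_E)

lemma coord_scale: "coord (smul a x) e = a * coord x e"
  by (simp add: coord_def representation_scale independent_E span_E)

lemma coord_sum: "coord (sum f A) e = (\<Sum>i\<in>A. coord (f i) e)"
  by (simp add: coord_def representation_sum independent_E span_E)

lemma coord_basis: "e \<in> E \<Longrightarrow> coord e f = (if f = e then 1 else 0)"
  by (simp add: coord_def representation_basis independent_E)

lemma coord_expand: "(\<Sum>e\<in>E. smul (coord x e) e) = x"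
  unfolding coord_def using finite_E by (intro sum_representation_eq independent_E) (auto simp: span_E)

lemma coord_combination: "f \<in> E \<Longrightarrow> coord (\<Sum>e\<in>E. smul (c e) e) f = c f"
  using finite_E by (simp add: coord_sum coord_scale coord_basis if_distrib sum.delta cong: if_cong)

text \<open>Balls of a sup norm with respect to the basis \<open>E\<close>. They are
  \<open>O_K\<close>-lattices, and products respect them only up to a constant.\<close>

definition L :: "int \<Rightarrow> 'b set" where
  "L j = {x. \<forall>e\<in>E. coord x e \<in> K.I j}"

lemma L_add: "x \<in> L j \<Longrightarrow> y \<in> L j \<Longrightarrow> x + y \<in> L j"
  by (auto simp: L_def coord_add K.I_add)

lemma L_diff: "x \<in> L j \<Longrightarrow> y \<in> L j \<Longrightarrow> x - y \<in> L j"
  by (auto simp: L_def coord_diff K.I_diff)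

lemma L_zero [simp]: "0 \<in> L j"
  by (auto simp: L_def coord_def representation_zero)

lemma L_sum: "(\<And>i. i \<in> A \<Longrightarrow> f i \<in> L j) \<Longrightarrow> sum f A \<in> L j"
  by (induction A rule: infinite_finite_induct) (auto intro: L_add)

lemma L_mono: "x \<in> L j \<Longrightarrow> i \<le> j \<Longrightarrow> x \<in> L i"
  by (auto simp: L_def intro: K.I_mono)

lemma L_scale: "a \<in> K.I i \<Longrightarrow> x \<in> L j \<Longrightarrow> smul a x \<in> L (i + j)"
  by (auto simp: L_def coord_scale K.I_mult)

lemma L_scale_iff: "a \<noteq> 0 \<Longrightarrow> smul a x \<in> L j \<longleftrightarrow> x \<in> L (j - v a)"
  by (auto simp: L_def coord_scale K.I_mult_iff)

lemma L_exhaust: "\<exists>j. x \<in> L j"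
proof -
  have "coord x e \<in> K.I (- (\<Sum>e\<in>E. \<bar>v (coord x e)\<bar>))" if "e \<in> E" for e
    using member_le_sum[of e E "\<lambda>e. \<bar>v (coord x e)\<bar>"] that finite_E by (auto simp: K.I_def)
  then show ?thesis by (auto simp: L_def)
qed

lemma L_exhaust_finite: "finite A \<Longrightarrow> \<exists>j. A \<subseteq> L j"
proof (induction A rule: finite_induct)
  case (insert x A)
  then obtain j where "A \<subseteq> L j" by blast
  moreover obtain i where "x \<in> L i" using L_exhaust by blast
  ultimately have "insert x A \<subseteq> L (min i j)"
    using L_mono[of _ i "min i j"] L_mono[of _ j "min i j"] by auto
  then show ?case by blast
qed simp

lemma L_separates: "x \<noteq> 0 \<Longrightarrow> \<exists>j. x \<notin> L j"
proof -
  assume "x \<noteq> 0"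
  then obtain e where "e \<in> E" "coord x e \<noteq> 0"
    using coord_expand[of x] by (metis (no_types, lifting) scale_zero_left sum.neutral)
  then have "x \<notin> L (v (coord x e) + 1)" by (auto simp: L_def K.I_def)
  then show ?thesis by blast
qed

lemma L_level:
  assumes "x \<noteq> 0"
  obtains j where "x \<in> L j" "x \<notin> L (j + 1)"
proof -
  obtain i where i: "x \<in> L i" using L_exhaust by blast
  obtain k where k: "x \<notin> L k" using L_separates[OF assms] by blast
  have "i < k" using i k by (meson L_mono not_le)
  then have ex: "x \<notin> L (i + int (nat (k - i)))" using k by simp
  define n where "n = (LEAST n. x \<notin> L (i + int n))"
  have n: "x \<notin> L (i + int n)" unfolding n_def by (rule LeastI[of "\<lambda>n. x \<notin> L (i + int n)", OF ex])
  then obtain m where m: "n = Suc m" using i by (cases n) auto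
  have "x \<in> L (i + int m)"
    using not_less_Least[of m "\<lambda>n. x \<notin> L (i + int n)"] m by (auto simp: n_def)
  then show thesis using n by (intro that[of "i + int m"]) (auto simp: m add_ac)
qed

text \<open>The constant bounds the finitely many products of basis vectors.\<close>

lemma L_mult:
  obtains c where "\<And>i j x y. x \<in> L i \<Longrightarrow> y \<in> L j \<Longrightarrow> x * y \<in> L (i + j + c)"
proof -
  obtain c where c: "(\<lambda>(e, f). e * f) ` (E \<times> E) \<subseteq> L c"
    using L_exhaust_finite[of "(\<lambda>(e, f). e * f) ` (E \<times> E)"] finite_E by blast
  have "x * y \<in> L (i + j + c)" if "x \<in> L i" "y \<in> L j" for i j x y
  proof -
    have "(\<Sum>e\<in>E. smul (coord x e) e) * (\<Sum>f\<in>E. smul (coord y f) f) =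
        (\<Sum>e\<in>E. \<Sum>f\<in>E. smul (coord x e * coord y f) (e * f))"
      by (simp add: sum_product scale_mult_left scale_mult_right mult.commute)
    then have "x * y = (\<Sum>e\<in>E. \<Sum>f\<in>E. smul (coord x e * coord y f) (e * f))"
      by (simp add: coord_expand)
    moreover have "smul (coord x e * coord y f) (e * f) \<in> L (i + j + c)" if "e \<in> E" "f \<in> E" for e f
      using \<open>x \<in> L i\<close> \<open>y \<in> L j\<close> that c by (intro L_scale K.I_mult) (auto simp: L_def)
    ultimately show ?thesis by (auto intro!: L_sum)
  qed
  then show thesis by (rule that)
qed

lemma L_cover_step: "\<exists>R. finite R \<and> (\<forall>x\<in>L 0. \<exists>r\<in>R. x - r \<in> L 1)"
proof -
  obtain R where R: "finite R" "\<And>a. a \<in> K.I 0 \<Longrightarrow> \<exists>r\<in>R. a - r \<in> K.I 1"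
    using residue_cover by blast
  let ?R = "(\<lambda>c. \<Sum>e\<in>E. smul (c e) e) ` (\<Pi>\<^sub>E e\<in>E. R)"
  have "\<exists>r\<in>?R. x - r \<in> L 1" if "x \<in> L 0" for x
  proof -
    have "\<forall>e\<in>E. \<exists>r. r \<in> R \<and> coord x e - r \<in> K.I 1" using that R by (auto simp: L_def)
    then obtain c where c: "\<And>e. e \<in> E \<Longrightarrow> c e \<in> R \<and> coord x e - c e \<in> K.I 1" by metis
    have "restrict c E \<in> (\<Pi>\<^sub>E e\<in>E. R)" using c by auto
    moreover have "x - (\<Sum>e\<in>E. smul (restrict c E e) e) \<in> L 1"
      unfolding L_def using c by (simp add: coord_diff coord_combination del: restrict_apply) simp
    ultimately show ?thesis by blast
  qed
  moreover have "finite ?R" using R finite_E by (intro finite_imageI finite_PiE) auto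
  ultimately show ?thesis by blast
qed

text \<open>Total boundedness: each step refines the cover by a scaled copy of the finite cover of
  \<open>L 0\<close> modulo \<open>L 1\<close>.\<close>

lemma L_cover: "\<exists>R. finite R \<and> (\<forall>x\<in>L j. \<exists>r\<in>R. x - r \<in> L (j + int n))"
proof (induction n)
  case 0
  show ?case by (intro exI[of _ "{0}"]) simp
next
  case (Suc n)
  then obtain R where R: "finite R" "\<And>x. x \<in> L j \<Longrightarrow> \<exists>r\<in>R. x - r \<in> L (j + int n)" by blast
  obtain S where S: "finite S" "\<And>x. x \<in> L 0 \<Longrightarrow> \<exists>r\<in>S. x - r \<in> L 1" using L_cover_step by blast
  obtain a where a: "a \<noteq> 0" "v a = j + int n" using exists_valuation by blast
  have "\<exists>r\<in>(\<lambda>(r, s). r + smul a s) ` (R \<times> S). x - r \<in> L (j + int (Suc n))" if x: "x \<in> L j" for x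
  proof -
    obtain r where r: "r \<in> R" "x - r \<in> L (j + int n)" using R x by blast
    define y where "y = smul (inverse a) (x - r)"
    have y: "x - r = smul a y" using a by (simp add: y_def)
    have "y \<in> L 0" using r a by (simp add: y L_scale_iff)
    then obtain s where s: "s \<in> S" "y - s \<in> L 1" using S by blast
    have "smul a (y - s) \<in> L (j + int (Suc n))" using a s by (simp add: L_scale_iff)
    then have "x - (r + smul a s) \<in> L (j + int (Suc n))"
      using y by (simp add: scale_right_diff_distrib algebra_simps)
    then show ?thesis using r s by (intro bexI[of _ "r + smul a s"]) auto
  qed
  then show ?case using R S
    by (intro exI[of _ "(\<lambda>(r, s). r + smul a s) ` (R \<times> S)"]) blast
qed

text \<open>By the ultrametric inequality small consecutive differences make a Cauchy sequence; the
  limit is taken coordinatewise.\<close>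

lemma L_complete:
  assumes y: "\<And>j. y (Suc j) - y j \<in> L (int j)"
  shows "\<exists>x. \<forall>j. x - y j \<in> L (int j)"
proof -
  have mono: "y (j + n) - y j \<in> L (int j)" for j n
  proof (induction n)
    case (Suc n)
    have "y (Suc (j + n)) - y (j + n) \<in> L (int j)" using y[of "j + n"] by (rule L_mono) simp
    from L_add[OF this Suc] show ?case by simp
  qed simp
  have close: "y i - y j \<in> L (int M)" if "M \<le> i" "M \<le> j" for i j M
    using L_diff[OF mono[of M "i - M"] mono[of M "j - M"]] that by simp
  have "\<exists>l. \<forall>j. l - coord (y j) e \<in> K.I (int j)" if e: "e \<in> E" for e
  proof -
    have "\<forall>N. \<exists>M. \<forall>i\<ge>M. \<forall>j\<ge>M. coord (y i) e - coord (y j) e \<in> val_ball v N"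
    proof (intro allI exI impI)
      fix N :: int and i j :: nat
      assume "nat N \<le> i" "nat N \<le> j"
      then have "y i - y j \<in> L N" by (rule L_mono[OF close]) simp
      then show "coord (y i) e - coord (y j) e \<in> val_ball v N"
        using e by (simp add: L_def coord_diff val_ball_eq)
    qed
    from complete[OF this] obtain l where
      l: "\<And>N. \<exists>M. \<forall>i\<ge>M. coord (y i) e - l \<in> K.I N" by (auto simp: val_ball_eq)
    have "l - coord (y j) e \<in> K.I (int j)" for j
    proof -
      obtain M where "\<And>i. i \<ge> M \<Longrightarrow> coord (y i) e - l \<in> K.I (int j)" using l by blast
      then have "coord (y (max M j)) e - l \<in> K.I (int j)" by simp
      moreover have "coord (y (max M j)) e - coord (y j) e \<in> K.I (int j)"
        using close[of j "max M j" j] e by (simp add: L_def coord_diff)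
      ultimately show ?thesis using K.I_diff by fastforce
    qed
    then show ?thesis by blast
  qed
  then obtain l where l: "\<And>e j. e \<in> E \<Longrightarrow> l e - coord (y j) e \<in> K.I (int j)" by metis
  then have "(\<Sum>e\<in>E. smul (l e) e) - y j \<in> L (int j)" for j
    by (simp add: L_def coord_diff coord_combination)
  then show ?thesis by blast
qed

text \<open>Bolzano-Weierstrass: nested balls around \<open>y j\<close>, each with infinitely many
  terms, are chosen by pigeonhole on the finite covers, and their centers converge.\<close>

lemma L_cluster_point:
  fixes s :: "nat \<Rightarrow> 'b"
  assumes s: "\<And>k. s k \<in> L 0"
  shows "\<exists>x. \<forall>j. infinite {k. s k - x \<in> L (int j)}"
proof -
  have "\<exists>y. \<forall>j. infinite {k. s k - y j \<in> L (int j)} \<and> y (Suc j) - y j \<in> L (int j)"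
  proof (rule dependent_nat_choice)
    show "\<exists>y. infinite {k. s k - y \<in> L (int 0)}" using s by (intro exI[of _ 0]) simp
  next
    fix y j assume inf: "infinite {k. s k - y \<in> L (int j)}"
    obtain R where R: "finite R" "\<And>x. x \<in> L (int j) \<Longrightarrow> \<exists>r\<in>R. x - r \<in> L (int j + 1)"
      using L_cover[of "int j" 1] by auto
    have "\<exists>r\<in>R. infinite {k \<in> {k. s k - y \<in> L (int j)}. s k - y - r \<in> L (int j + 1)}"
      using R by (intro pigeonhole_infinite_rel inf) auto
    then obtain r where r: "infinite {k \<in> {k. s k - y \<in> L (int j)}. s k - y - r \<in> L (int j + 1)}"
      by blast
    then obtain k where k: "s k - y \<in> L (int j)" "s k - y - r \<in> L (int j + 1)"
      using not_finite_existsD by fastforce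
    have "r \<in> L (int j)" using L_diff[OF k(1) L_mono[OF k(2), of "int j"]] by simp
    moreover have "infinite {k. s k - (y + r) \<in> L (int (Suc j))}"
      by (rule infinite_super[OF _ r]) (auto simp: algebra_simps)
    ultimately show "\<exists>y'. infinite {k. s k - y' \<in> L (int (Suc j))} \<and> y' - y \<in> L (int j)"
      by (intro exI[of _ "y + r"]) simp
  qed
  then obtain y where y: "\<And>j. infinite {k. s k - y j \<in> L (int j)}" "\<And>j. y (Suc j) - y j \<in> L (int j)"
    by blast
  obtain x where x: "\<And>j. x - y j \<in> L (int j)" using L_complete[of y] y(2) by blast
  have "infinite {k. s k - x \<in> L (int j)}" for j
  proof (rule infinite_super[OF _ y(1)[of j]], safe)
    fix k assume "s k - y j \<in> L (int j)"
    from L_diff[OF this x[of j]] show "s k - x \<in> L (int j)" by simp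
  qed
  then show ?thesis by blast
qed

text \<open>Compactness of the unit sphere: otherwise there are unit vectors \<open>xs k\<close> and
  \<open>zs k\<close> whose products tend to 0. A cluster point \<open>x\<close> of the
  \<open>xs k\<close> is nonzero, and multiplying by \<open>inverse x\<close> makes some
  \<open>zs k\<close> small, contrary to its norm.\<close>

lemma L_inverse:
  obtains c where "\<And>x j. x \<notin> L j \<Longrightarrow> inverse x \<in> L (c - j)"
proof (rule ccontr)
  assume "\<not> thesis"
  then have neg: "\<exists>x j. x \<notin> L j \<and> inverse x \<notin> L (c - j)" for c using that by blast
  \<comment> \<open>A vector outside \<open>L (1 - j)\<close> needs a factor of value at least
    \<open>j\<close> to reach the unit sphere, the part of \<open>L 0\<close> outside
    \<open>L 1\<close>.\<close>
  have norm: "\<exists>a x'. a \<noteq> 0 \<and> x' = smul a x \<and> x' \<in> L 0 \<and> x' \<notin> L 1 \<and> j \<le> v a"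
    if "x \<notin> L (1 - j)" for x j
  proof -
    have "x \<noteq> 0" using that by auto
    then obtain m where m: "x \<in> L m" "x \<notin> L (m + 1)" by (rule L_level)
    obtain a where a: "a \<noteq> 0" "v a = - m" using exists_valuation by blast
    have "m < 1 - j" using that m(1) by (meson L_mono not_le)
    then show ?thesis using m a by (intro exI[of _ a] exI[of _ "smul a x"]) (simp add: L_scale_iff add.commute)
  qed
  obtain d where d: "1 \<in> L d" using L_exhaust by blast
  have "\<exists>x z. x \<in> L 0 \<and> x \<notin> L 1 \<and> z \<in> L 0 \<and> z \<notin> L 1 \<and> x * z \<in> L (int k + d)" for k
  proof -
    obtain x j where x: "x \<notin> L j" "inverse x \<notin> L (1 - int k - j)"
      using neg[of "1 - int k"] by (auto simp: algebra_simps)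
    obtain a where a: "a \<noteq> 0" "smul a x \<in> L 0" "smul a x \<notin> L 1" "1 - j \<le> v a"
      using norm[of x "1 - j"] x(1) by auto
    obtain b where b: "b \<noteq> 0" "smul b (inverse x) \<in> L 0" "smul b (inverse x) \<notin> L 1" "int k + j \<le> v b"
      using norm[of "inverse x" "int k + j"] x(2) by (auto simp: algebra_simps)
    have "x \<noteq> 0" using x(1) by auto
    then have "smul a x * smul b (inverse x) = smul (a * b) 1"
      by (simp add: scale_mult_left scale_mult_right)
    moreover have "a * b \<in> K.I (int k)" using a b by (simp add: K.I_def K.w_mult)
    ultimately show ?thesis using a b d L_scale by metis
  qed
  then obtain xs zs where xz: "\<And>k. xs k \<in> L 0" "\<And>k. xs k \<notin> L 1" "\<And>k. zs k \<in> L 0" "\<And>k. zs k \<notin> L 1"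
    "\<And>k. xs k * zs k \<in> L (int k + d)" by metis
  obtain x where x: "\<And>j. infinite {k. xs k - x \<in> L (int j)}" using L_cluster_point xz(1) by blast
  obtain k where k: "xs k - x \<in> L 1" using x[of 1] not_finite_existsD by fastforce
  have "x \<noteq> 0" using k xz(2)[of k] by auto
  obtain i where i: "inverse x \<in> L i" using L_exhaust by blast
  obtain c where c: "\<And>i j x y. x \<in> L i \<Longrightarrow> y \<in> L j \<Longrightarrow> x * y \<in> L (i + j + c)" using L_mult by blast
  \<comment> \<open>Large enough that \<open>xs k * zs k\<close> and
    \<open>(xs k - x) * zs k\<close> both lie in \<open>L (1 - i - c)\<close>, which multiplication
    by \<open>inverse x\<close> carries into \<open>L 1\<close>.\<close>
  define j where "j = nat (1 + \<bar>d\<bar> + \<bar>c\<bar> + \<bar>i\<bar> + \<bar>c\<bar>)"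
  obtain k where k: "j \<le> k" "xs k - x \<in> L (int j)"
    using x[of j] by (metis (no_types, lifting) infinite_nat_iff_unbounded_le mem_Collect_eq)
  have 1: "xs k * zs k \<in> L (1 - i - c)" using xz(5)[of k] by (rule L_mono) (use k in \<open>simp add: j_def\<close>)
  have "(xs k - x) * zs k \<in> L (int j + 0 + c)" using k xz(3) by (intro c)
  then have 2: "(xs k - x) * zs k \<in> L (1 - i - c)" by (rule L_mono) (simp add: j_def)
  have "x * zs k \<in> L (1 - i - c)" using L_diff[OF 1 2] by (simp add: algebra_simps)
  from c[OF i this] have "inverse x * (x * zs k) \<in> L 1" by simp
  then have "zs k \<in> L 1" using \<open>x \<noteq> 0\<close> by (simp add: mult.assoc[symmetric])
  then show False using xz(4) by blast
qed


section \<open>Extension of the valuation by the norm\<close>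

text \<open>The function is \<open>v\<close> of the determinant of left multiplication, the regular
  norm. Multiplicativity holds because \<open>M\<close> turns products into matrix products, and the
  lower bound comes from the size of the entries of \<open>M x\<close>.\<close>

lemma norm_exists:
  "\<exists>\<delta>. (\<forall>x y. x \<noteq> 0 \<longrightarrow> y \<noteq> 0 \<longrightarrow> \<delta> (x * y) = \<delta> x + \<delta> y) \<and>
     (\<forall>a x. a \<noteq> 0 \<longrightarrow> x \<noteq> 0 \<longrightarrow> \<delta> (smul a x) = int (card E) * v a + \<delta> x) \<and>
     (\<exists>C. \<forall>x j. x \<noteq> 0 \<longrightarrow> x \<in> L j \<longrightarrow> int (card E) * j + C \<le> \<delta> x)"
proof -
  obtain f where f: "bij_betw f {0..<card E} E" using ex_bij_betw_nat_finite[OF finite_E] by blast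
  define N where "N = card E"
  define M where "M x = mat N N (\<lambda>(i, k). coord (x * f k) (f i))" for x
  define \<delta> where "\<delta> x = v (Determinant.det (M x))" for x
  have fE: "f i \<in> E" if "i < N" for i using f that by (auto simp: bij_betw_def N_def)
  have finj: "f i = f k \<longleftrightarrow> i = k" if "i < N" "k < N" for i k
    using f that by (auto simp: bij_betw_def N_def inj_on_def)
  have carr: "M x \<in> carrier_mat N N" for x by (simp add: M_def)
  have M_mult: "M (x * y) = M x * M y" for x y
  proof (rule eq_matI)
    fix i k assume "i < dim_row (M x * M y)" "k < dim_col (M x * M y)"
    then have ik: "i < N" "k < N" by (simp_all add: M_def)
    have "y * f k = (\<Sum>l = 0..<N. smul (coord (y * f k) (f l)) (f l))"
      using coord_expand[of "y * f k"] sum.reindex_bij_betw[OF f, of "\<lambda>e. smul (coord (y * f k) e) e"]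
      by (simp add: N_def)
    then have "x * y * f k = (\<Sum>l = 0..<N. smul (coord (y * f k) (f l)) (x * f l))"
      by (metis (no_types, lifting) mult.assoc sum_distrib_left scale_mult_right sum.cong)
    then have "coord (x * y * f k) (f i) = (\<Sum>l = 0..<N. coord (x * f l) (f i) * coord (y * f k) (f l))"
      by (simp add: coord_sum coord_scale mult.commute)
    then show "M (x * y) $$ (i, k) = (M x * M y) $$ (i, k)"
      using ik by (simp add: M_def scalar_prod_def)
  qed (simp_all add: M_def)
  have M_one: "M 1 = 1\<^sub>m N"
    by (rule eq_matI) (auto simp: M_def coord_basis fE finj)
  have nz: "Determinant.det (M x) \<noteq> 0" if "x \<noteq> 0" for x
  proof
    assume "Determinant.det (M x) = 0"
    then have "Determinant.det (M (x * inverse x)) = 0"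
      unfolding M_mult by (simp add: det_mult[OF carr carr])
    then show False using that by (simp add: M_one)
  qed
  have M_smul: "M (smul a x) = a \<cdot>\<^sub>m M x" for a x
    by (rule eq_matI) (auto simp: M_def scale_mult_left coord_scale)
  have 1: "\<delta> (x * y) = \<delta> x + \<delta> y" if "x \<noteq> 0" "y \<noteq> 0" for x y
    using nz that by (simp add: \<delta>_def M_mult det_mult[OF carr carr] K.w_mult)
  have 2: "\<delta> (smul a x) = int (card E) * v a + \<delta> x" if "a \<noteq> 0" "x \<noteq> 0" for a x
    using nz that carr[of x] by (simp add: \<delta>_def M_smul K.w_mult K.w_power N_def)
  obtain c where c: "\<And>i j x y. x \<in> L i \<Longrightarrow> y \<in> L j \<Longrightarrow> x * y \<in> L (i + j + c)" using L_mult by blast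
  obtain d where d: "E \<subseteq> L d" using L_exhaust_finite[OF finite_E] by blast
  have 3: "int (card E) * j + int N * (d + c) \<le> \<delta> x" if x: "x \<noteq> 0" "x \<in> L j" for x j
  proof -
    have "M x $$ (i, k) \<in> K.I (j + d + c)" if "i < N" "k < N" for i k
      using c[OF x(2), of "f k" d] d fE that by (auto simp: M_def L_def)
    from det_in_I[OF carr this] nz[OF x(1)] show ?thesis
      by (simp add: K.I_def \<delta>_def N_def algebra_simps)
  qed
  show ?thesis using 1 2 3 by blast
qed

lemma smul_of_nat: "of_nat m * x = smul (of_nat m) x"
  by (induction m) (simp_all add: scale_left_distrib distrib_right)

text \<open>The norm valuation differs from \<open>N\<close> times the coordinate level by a bounded
  amount: from below by the determinant estimate, from above through inverses. This yields the
  ultrametric inequality, finite quotients and finite generation; dividing by the least positive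
  value normalises it.\<close>

theorem extended_valuation_exists:
  assumes "E \<noteq> {}"
  shows "\<exists>w e. discretely_valued_division_ring w \<and> 0 < e \<and>
    (\<forall>a x. a \<noteq> 0 \<longrightarrow> x \<noteq> 0 \<longrightarrow> w (smul a x) = e * v a + w x) \<and>
    (\<exists>F. finite F \<and> valuation.I w 0 = int_span v smul F)"
proof -
  define N where "N = int (card E)"
  have N: "0 < N" using assms finite_E by (simp add: N_def card_gt_0_iff)
  obtain \<delta> C1 where mult: "\<And>x y. x \<noteq> 0 \<Longrightarrow> y \<noteq> 0 \<Longrightarrow> \<delta> (x * y) = \<delta> x + \<delta> y"
    and smul: "\<And>a x. a \<noteq> 0 \<Longrightarrow> x \<noteq> 0 \<Longrightarrow> \<delta> (smul a x) = N * v a + \<delta> x"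
    and lower: "\<And>x j. x \<noteq> 0 \<Longrightarrow> x \<in> L j \<Longrightarrow> N * j + C1 \<le> \<delta> x"
    using norm_exists unfolding N_def by blast
  obtain c where c: "\<And>x j. x \<notin> L j \<Longrightarrow> inverse x \<in> L (c - j)" using L_inverse by blast
  have "\<delta> 1 = 0" using mult[of 1 1] by simp
  have inv: "\<delta> (inverse x) = - \<delta> x" if "x \<noteq> 0" for x
    using mult[of x "inverse x"] that \<open>\<delta> 1 = 0\<close> by simp
  have pow: "\<delta> (x ^ m) = int m * \<delta> x" if "x \<noteq> 0" for x m
    using that by (induction m) (simp_all add: \<open>\<delta> 1 = 0\<close> mult algebra_simps)
  \<comment> \<open>If \<open>x\<close> were outside \<open>L j\<close>, its inverse would be in
    \<open>L (c - j)\<close>, and the lower bound for the inverse would bound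
    \<open>\<delta> x\<close> from above.\<close>
  have upper: "x \<in> L j" if "x \<noteq> 0" "N * j - N * c - C1 < \<delta> x" for x j
  proof (rule ccontr)
    assume "x \<notin> L j"
    from lower[OF _ c[OF this]] that show False by (simp add: inv algebra_simps)
  qed
  \<comment> \<open>All powers of \<open>x\<close> have nonnegative value and hence lie in one fixed
    lattice, which is closed under integer combinations. So the powers of \<open>1 + x\<close> lie
    there too and their values are bounded below, which a negative \<open>\<delta> (1 + x)\<close>
    contradicts.\<close>
  have add1: "0 \<le> \<delta> (1 + x)" if "0 \<le> \<delta> x" "x \<noteq> 0" "1 + x \<noteq> 0" for x
  proof (rule ccontr)
    assume neg: "\<not> 0 \<le> \<delta> (1 + x)"
    \<comment> \<open>Any \<open>j\<close> so low that every element of nonnegative value lies in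
      \<open>L j\<close>.\<close>
    obtain j where j: "N * j - N * c - C1 < 0"
    proof
      have "N * (- \<bar>c\<bar> - \<bar>C1\<bar> - 1) - N * c - C1 \<le> - (N * (\<bar>C1\<bar> + 1)) - C1"
        using N mult_left_mono[of "- c" "\<bar>c\<bar>" N] by (simp add: algebra_simps abs_ge_minus_self)
      also have "\<dots> \<le> - (1 * (\<bar>C1\<bar> + 1)) - C1"
        using N by (intro diff_right_mono le_imp_neg_le mult_right_mono) auto
      also have "\<dots> < 0" by simp
      finally show "N * (- \<bar>c\<bar> - \<bar>C1\<bar> - 1) - N * c - C1 < 0" .
    qed
    have "x ^ i \<in> L j" for i
    proof (rule upper)
      have "0 \<le> int i * \<delta> x" using that by simp
      then show "N * j - N * c - C1 < \<delta> (x ^ i)" using j pow[of x i] that by linarith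
    qed (use that in simp)
    then have "of_nat n * x ^ i \<in> L j" for n i
      unfolding smul_of_nat using L_scale[of "of_nat n" 0 "x ^ i" j] by simp
    then have "(1 + x) ^ m \<in> L j" for m unfolding one_plus_power by (intro L_sum)
    then have "N * j + C1 \<le> int m * \<delta> (1 + x)" for m
      using lower[of "(1 + x) ^ m" j] that by (simp add: pow)
    from this[of "nat (\<bar>N * j + C1\<bar> + 1)"]
    have "N * j + C1 \<le> (\<bar>N * j + C1\<bar> + 1) * \<delta> (1 + x)" by simp
    also have "\<dots> \<le> (\<bar>N * j + C1\<bar> + 1) * (- 1)" using neg by (intro mult_left_mono) auto
    finally show False by simp
  qed
  have add: "min (\<delta> x) (\<delta> y) \<le> \<delta> (x + y)" if "x \<noteq> 0" "y \<noteq> 0" "x + y \<noteq> 0" for x y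
  proof -
    have *: "\<delta> x \<le> \<delta> (x + y)" if "\<delta> x \<le> \<delta> y" "x \<noteq> 0" "y \<noteq> 0" "x + y \<noteq> 0" for x y
    proof -
      have eq: "x + y = x * (1 + inverse x * y)" using that by (simp add: distrib_left mult.assoc[symmetric])
      then have nz: "1 + inverse x * y \<noteq> 0" using that by auto
      have "0 \<le> \<delta> (1 + inverse x * y)" using that nz by (intro add1) (simp_all add: mult inv)
      then show ?thesis unfolding eq using that nz by (simp add: mult)
    qed
    show ?thesis using *[of x y] *[of y x] that by (auto simp: add.commute min_def)
  qed
  interpret \<delta>: valuation \<delta> by unfold_locales (auto simp: mult intro: add)
  obtain t where t: "t \<noteq> 0" "v t = 1" using v_normalised by blast
  have dt: "\<delta> (smul t 1) = N" "smul t 1 \<noteq> 0" using t by (auto simp: smul)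
  \<comment> \<open>The values form a subgroup of the integers and \<open>d\<close> is its positive
    generator; \<open>N\<close>, the value of the scalar \<open>t\<close>, shows that positive
    values occur.\<close>
  define d where "d = (LEAST d::nat. 0 < d \<and> (\<exists>x. x \<noteq> 0 \<and> \<delta> x = int d))"
  have "0 < d \<and> (\<exists>x. x \<noteq> 0 \<and> \<delta> x = int d)"
    unfolding d_def by (rule LeastI[of _ "nat N"]) (use dt N in \<open>auto intro!: exI[of _ "smul t 1"]\<close>)
  then obtain p where p: "p \<noteq> 0" "\<delta> p = int d" and d: "0 < d" by blast
  have least: "d \<le> i" if "0 < i" "x \<noteq> 0" "\<delta> x = int i" for x i
    unfolding d_def using that by (intro Least_le) auto
  have pint: "\<exists>y. y \<noteq> 0 \<and> \<delta> y = i * int d" for i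
  proof (cases "0 \<le> i")
    case True
    then show ?thesis using p by (intro exI[of _ "p ^ nat i"]) (simp add: pow)
  next
    case False
    then show ?thesis using p by (intro exI[of _ "inverse (p ^ nat (- i))"]) (simp add: pow inv)
  qed
  have dvd: "int d dvd \<delta> x" if x: "x \<noteq> 0" for x
  proof -
    obtain y where y: "y \<noteq> 0" "\<delta> y = - (\<delta> x div int d) * int d" using pint by blast
    have xy: "\<delta> (x * y) = \<delta> x mod int d"
      using x y by (simp add: mult minus_div_mult_eq_mod)
    have "\<delta> x mod int d = 0"
    proof (rule ccontr)
      assume "\<delta> x mod int d \<noteq> 0"
      moreover have "0 \<le> \<delta> x mod int d" "\<delta> x mod int d < int d" using d by simp_all
      ultimately have pos: "0 < nat (\<delta> x mod int d)" "nat (\<delta> x mod int d) < d" by linarith+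
      have "\<delta> (x * y) = int (nat (\<delta> x mod int d))" using xy \<open>0 \<le> \<delta> x mod int d\<close> by simp
      from least[OF pos(1) _ this] show False using pos(2) x y(1) by simp
    qed
    then show ?thesis by auto
  qed
  define w where "w x = \<delta> x div int d" for x
  have w: "\<delta> x = int d * w x" if "x \<noteq> 0" for x using dvd[OF that] by (simp add: w_def)
  have wle: "i \<le> w x \<longleftrightarrow> int d * i \<le> \<delta> x" if "x \<noteq> 0" for x i using d by (simp add: w[OF that])
  interpret w: valuation w
  proof
    fix x y :: 'b assume nz: "x \<noteq> 0" "y \<noteq> 0"
    have "int d * w (x * y) = int d * (w x + w y)"
      using mult[OF nz] nz by (simp add: w distrib_left)
    then show "w (x * y) = w x + w y" using d by simp
    assume "x + y \<noteq> 0"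
    then show "min (w x) (w y) \<le> w (x + y)"
      using add[OF nz] nz d by (auto simp: w min_def split: if_splits)
  qed
  define e where "e = w (smul t 1)"
  have e: "N = int d * e" using dt w by (simp add: e_def)
  then have "0 < e" using N by (simp add: zero_less_mult_iff)
  have wsmul: "w (smul a x) = e * v a + w x" if "a \<noteq> 0" "x \<noteq> 0" for a x
  proof -
    have "int d * w (smul a x) = int d * (e * v a + w x)"
      using smul[OF that] that by (simp add: w e distrib_left mult.assoc)
    then show ?thesis using d by simp
  qed
  \<comment> \<open>\<open>w.I 0\<close> is contained in some \<open>L i\<close> and
    \<open>w.I j\<close> contains some \<open>L k\<close>, so a finite cover of \<open>L i\<close>
    modulo \<open>L k\<close> serves for the quotient of \<open>w.I 0\<close>.\<close>
  have cover: "\<exists>k R. L k \<subseteq> w.I j \<and> finite R \<and> R \<subseteq> w.I 0 \<and> (\<forall>x\<in>w.I 0. \<exists>r\<in>R. x - r \<in> L k)" for j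
  proof -
    define k where "k = \<bar>int d * j\<bar> + \<bar>C1\<bar>"
    have "L k \<subseteq> w.I j"
    proof
      fix x assume "x \<in> L k"
      moreover have "k \<le> N * k" using N mult_right_mono[of 1 N k] by (simp add: k_def)
      ultimately show "x \<in> w.I j"
        using lower[of x k] by (cases "x = 0") (auto simp: w.I_def wle k_def)
    qed
    define i where "i = - \<bar>c\<bar> - \<bar>C1\<bar> - 1"
    have "w.I 0 \<subseteq> L i"
    proof
      fix x assume x: "x \<in> w.I 0"
      have "N * (i - c) \<le> 1 * (i - c)" using N by (intro mult_right_mono_neg) (auto simp: i_def)
      then have "N * i - N * c - C1 < 0" by (simp add: right_diff_distrib i_def)
      then show "x \<in> L i" using x upper[of x i] wle[of x 0]
        by (cases "x = 0") (auto simp: w.I_def)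
    qed
    obtain R where R: "finite R" "\<And>x. x \<in> L i \<Longrightarrow> \<exists>r\<in>R. x - r \<in> L k"
    proof -
      have "i + int (nat (k - i)) = k" by (simp add: k_def i_def)
      then show thesis using L_cover[of i "nat (k - i)"] that by auto
    qed
    \<comment> \<open>A representative from \<open>L i\<close> need not be integral; where possible
      it is replaced by an integral element of its class modulo \<open>L k\<close>.\<close>
    define f where "f r = (SOME x. x \<in> w.I 0 \<and> x - r \<in> L k)" for r
    define R' where "R' = f ` {r \<in> R. \<exists>x. x \<in> w.I 0 \<and> x - r \<in> L k}"
    have f: "f r \<in> w.I 0 \<and> f r - r \<in> L k" if "\<exists>x. x \<in> w.I 0 \<and> x - r \<in> L k" for r
      unfolding f_def by (rule someI_ex[OF that])
    have "\<exists>r\<in>R'. x - r \<in> L k" if x: "x \<in> w.I 0" for x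
    proof -
      obtain r where r: "r \<in> R" "x - r \<in> L k" using R x \<open>w.I 0 \<subseteq> L i\<close> by blast
      then have "f r \<in> R'" "f r - r \<in> L k" using f x by (auto simp: R'_def)
      then show ?thesis using L_diff[OF r(2), of "f r - r"] by auto
    qed
    moreover have "finite R'" "R' \<subseteq> w.I 0" using R f by (auto simp: R'_def)
    ultimately show ?thesis using \<open>L k \<subseteq> w.I j\<close> by blast
  qed
  have "discretely_valued_division_ring w"
  proof
    have "int d * w p = int d * 1" using w p by simp
    then show "\<exists>p. p \<noteq> 0 \<and> w p = 1" using d p(1) by auto
    show "\<exists>R. finite R \<and> R \<subseteq> w.I 0 \<and> (\<forall>x\<in>w.I 0. \<exists>r\<in>R. x - r \<in> w.I j)" for j
    proof -
      obtain k R where "L k \<subseteq> w.I j" "finite R" "R \<subseteq> w.I 0" "\<forall>x\<in>w.I 0. \<exists>r\<in>R. x - r \<in> L k"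
        using cover[of j] by (elim exE conjE)
      then show ?thesis by (intro exI[of _ R]) (meson subsetD)
    qed
  qed
  moreover have "\<exists>F. finite F \<and> w.I 0 = int_span v smul F"
  proof -
    obtain k R where R: "L k \<subseteq> w.I 0" "finite R" "R \<subseteq> w.I 0" "\<And>x. x \<in> w.I 0 \<Longrightarrow> \<exists>r\<in>R. x - r \<in> L k"
      using cover[of 0] by blast
    obtain a where a: "a \<noteq> 0" "v a = k" using exists_valuation by blast
    \<comment> \<open>Representatives of \<open>w.I 0\<close> modulo \<open>L k\<close>, together
      with the basis of \<open>L k\<close> obtained by scaling \<open>E\<close>.\<close>
    define F where "F = R \<union> smul a ` E"
    have F: "finite F" using R finite_E by (simp add: F_def)
    have Lk: "x \<in> int_span v smul F" if "x \<in> L k" for x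
    proof -
      have "x = (\<Sum>e\<in>E. smul (coord x e / a) (smul a e))"
        using coord_expand[of x] a by simp
      also have "\<dots> \<in> int_span v smul F"
      proof (intro int_span_sum int_span_scale F)
        fix e assume e: "e \<in> E"
        then have "a * (coord x e / a) \<in> K.I k" using that a by (simp add: L_def)
        then show "coord x e / a \<in> K.I 0" using a(1) unfolding K.I_mult_iff[OF a(1)] by (simp add: a(2))
        show "smul a e \<in> F" using e by (simp add: F_def imageI)
      qed
      finally show ?thesis .
    qed
    have "w.I 0 \<subseteq> int_span v smul F"
    proof
      fix x assume "x \<in> w.I 0"
      then obtain r where r: "r \<in> R" "x - r \<in> L k" using R by blast
      then have "r + (x - r) \<in> int_span v smul F"
        using F by (intro int_span_add Lk int_span_base) (auto simp: F_def)
      then show "x \<in> int_span v smul F" by simp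
    qed
    moreover have "int_span v smul F \<subseteq> w.I 0"
    proof (rule int_span_subset)
      have "smul a e \<in> L k" if "e \<in> E" for e
        using that a by (auto simp: L_def coord_scale coord_basis K.I_def)
      then show "F \<subseteq> w.I 0" using R by (auto simp: F_def)
      show "smul b x \<in> w.I 0" if "b \<in> K.I 0" "x \<in> w.I 0" for b x
        using that \<open>0 < e\<close> by (cases "b = 0"; cases "x = 0") (auto simp: w.I_def K.I_def wsmul)
    qed (auto intro: w.I_add)
    ultimately show ?thesis using F by blast
  qed
  ultimately show ?thesis using wsmul \<open>0 < e\<close> by blast
qed

end

section \<open>Maximal orders of the matrix ring\<close>

no_notation vec_index (infixl \<open>$\<close> 100)
hide_const (open) Matrix.mat Matrix.vec

section \<open>Two-by-two matrices and conjugation\<close>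

definition m2 :: "'b \<Rightarrow> 'b \<Rightarrow> 'b \<Rightarrow> 'b \<Rightarrow> 'b^2^2" where
  "m2 a b c d = (\<chi> i j. if i = 1 then (if j = 1 then a else b) else (if j = 1 then c else d))"

lemma m2_nth [simp]:
  "m2 a b c d $ 1 $ 1 = a" "m2 a b c d $ 1 $ 2 = b" "m2 a b c d $ 2 $ 1 = c" "m2 a b c d $ 2 $ 2 = d"
  by (simp_all add: m2_def)

lemma m2_cases: obtains a b c d where "A = m2 a b c d"
proof
  show "A = m2 (A $ 1 $ 1) (A $ 1 $ 2) (A $ 2 $ 1) (A $ 2 $ 2)" by (simp add: Finite_Cartesian_Product.vec_eq_iff forall_2)
qed

lemma m2_eq_iff [simp]: "m2 a b c d = m2 a' b' c' d' \<longleftrightarrow> a = a' \<and> b = b' \<and> c = c' \<and> d = d'"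
  by (auto simp: Finite_Cartesian_Product.vec_eq_iff forall_2)

lemma m2_mult [simp]: "m2 a b c d ** m2 a' b' c' d' =
    m2 (a * a' + b * c') (a * b' + b * d') (c * a' + d * c') (c * b' + d * d')"
  by (simp add: Finite_Cartesian_Product.vec_eq_iff forall_2 matrix_matrix_mult_def sum_2)

lemma m2_add [simp]: "m2 a b c d + m2 a' b' c' d' = m2 (a + a') (b + b') (c + c') (d + d')"
  by (simp add: Finite_Cartesian_Product.vec_eq_iff forall_2)

lemma m2_diff [simp]: "m2 a b c d - m2 a' b' c' d' = m2 (a - a') (b - b') (c - c') (d - d')"
  by (simp add: Finite_Cartesian_Product.vec_eq_iff forall_2)

lemma m2_one: "mat 1 = m2 1 0 0 1"
  by (simp add: Finite_Cartesian_Product.vec_eq_iff forall_2 Finite_Cartesian_Product.mat_def)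

lemma matrix_mul_zero [simp]: "0 ** A = (0 :: 'b::division_ring^2^2)" "A ** 0 = (0 :: 'b::division_ring^2^2)"
  by (simp_all add: Finite_Cartesian_Product.vec_eq_iff matrix_matrix_mult_def)

lemma m2_zero: "0 = m2 0 0 0 0"
  by (simp add: Finite_Cartesian_Product.vec_eq_iff forall_2)

lemma mat2_scale_m2 [simp]: "mat2_scale smul t (m2 a b c d) = m2 (smul t a) (smul t b) (smul t c) (smul t d)"
  by (simp add: Finite_Cartesian_Product.vec_eq_iff forall_2 mat2_scale_def)

lemma matrix_mul_diff_right: "(A :: 'b::division_ring^2^2) ** (B - C) = A ** B - A ** (C :: 'b^2^2)"
  by (cases A rule: m2_cases; cases B rule: m2_cases; cases C rule: m2_cases) (simp add: algebra_simps)

lemma matrix_mul_diff_left: "(B - C) ** (A :: 'b::division_ring^2^2) = B ** A - (C :: 'b^2^2) ** A"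
  by (cases A rule: m2_cases; cases B rule: m2_cases; cases C rule: m2_cases) (simp add: algebra_simps)

lemma matrix_mul_add_left: "(B + C) ** (A :: 'b::division_ring^2^2) = B ** A + (C :: 'b^2^2) ** A"
  by (cases A rule: m2_cases; cases B rule: m2_cases; cases C rule: m2_cases) (simp add: algebra_simps)

text \<open>The inverse is a second argument, so that conjugates are written without an inverse
  function.\<close>

definition inv_pair :: "'b::division_ring^2^2 \<Rightarrow> 'b^2^2 \<Rightarrow> bool" where
  "inv_pair g h \<longleftrightarrow> g ** h = mat 1 \<and> h ** g = mat 1"

lemma inv_pair_sym: "inv_pair g h \<Longrightarrow> inv_pair h g"
  by (simp add: inv_pair_def)

lemma inv_pair_cancel [simp]:
  assumes "inv_pair g h"
  shows "A ** g ** h = A" "A ** h ** g = A" "g ** h = mat 1" "h ** g = mat 1"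
  using assms by (simp_all add: inv_pair_def flip: matrix_mul_assoc)

lemma inv_pair_mult:
  assumes "inv_pair g h" "inv_pair k l"
  shows "inv_pair (g ** k) (l ** h)"
  using assms by (simp add: inv_pair_def[of "_ ** _"] matrix_mul_assoc)

lemma conj_mult:
  assumes "inv_pair g h"
  shows "h ** (X ** Y) ** g = (h ** X ** g) ** (h ** Y ** g)"
proof -
  have "(h ** X ** g) ** (h ** Y ** g) = h ** X ** (g ** h) ** Y ** g" by (simp only: matrix_mul_assoc)
  then show ?thesis using assms by (simp add: matrix_mul_assoc)
qed

lemma conj_cancel: "inv_pair g h \<Longrightarrow> h ** (g ** A ** h) ** g = A"
  by (simp add: matrix_mul_assoc)

lemma inv_pair_one [simp]: "inv_pair (mat 1) (mat 1)"
  by (simp add: inv_pair_def)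

lemma inv_pair_upper:
  "p \<noteq> 0 \<Longrightarrow> q \<noteq> 0 \<Longrightarrow> inv_pair (m2 p x 0 q) (m2 (inverse p) (- (inverse p * x * inverse q)) 0 (inverse q))"
  by (simp add: inv_pair_def m2_one mult.assoc[symmetric]) (simp add: mult.assoc)

lemma inv_pair_upperD:
  assumes "inv_pair (m2 p x 0 q) h"
  shows "p \<noteq> 0" "q \<noteq> 0"
  using assms by (cases h rule: m2_cases; auto simp: inv_pair_def m2_one)+

lemma inv_pair_swap: "inv_pair (m2 0 1 1 0) (m2 0 1 1 0)"
  by (simp add: inv_pair_def m2_one)

lemma mat2_scale_mult:
  assumes "central_division_algebra smul"
  shows "mat2_scale smul t A ** B = mat2_scale smul t (A ** B)"
    and "A ** mat2_scale smul t B = mat2_scale smul t (A ** B)"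
proof -
  interpret central_division_algebra smul by fact
  show "mat2_scale smul t A ** B = mat2_scale smul t (A ** B)"
    and "A ** mat2_scale smul t B = mat2_scale smul t (A ** B)"
    by (cases A rule: m2_cases; cases B rule: m2_cases;
        simp add: scale_mult_left scale_mult_right scale_right_distrib)+
qed

lemma carrier_Quot: "carrier (R Quot J) = (\<lambda>x. J +>\<^bsub>R\<^esub> x) ` carrier R"
  by (auto simp: FactRing_def A_RCOSETS_def RCOSETS_def a_r_coset_def)

lemma mult_Quot: "X \<otimes>\<^bsub>R Quot J\<^esub> Y = rcoset_mult R J X Y"
  by (simp add: FactRing_def)

lemma minus_mat2_ring [simp]: "\<ominus>\<^bsub>mat2_ring\<^esub> (X :: 'b::division_ring^2^2) = - X"
proof -
  interpret R: ring "mat2_ring :: ('b^2^2) ring" by (rule ring_mat2_ring)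
  show ?thesis by (rule R.minus_equality) (simp_all add: mat2_ring_def)
qed

lemma mat2_ring_simps [simp]:
  fixes X Y :: "'b::division_ring^2^2"
  shows "X \<otimes>\<^bsub>mat2_ring\<^esub> Y = X ** Y" "X \<oplus>\<^bsub>mat2_ring\<^esub> Y = X + Y"
    "\<zero>\<^bsub>mat2_ring\<^esub> = (0 :: 'b^2^2)" "\<one>\<^bsub>mat2_ring\<^esub> = (mat 1 :: 'b^2^2)"
  by (simp_all add: mat2_ring_def)

section \<open>Orders in the matrix ring\<close>

text \<open>Interface to the extended valuation: \<open>e\<close> is the ramification index of
  \<open>B\<close> over \<open>K\<close>.\<close>

locale valued_division_algebra =
  nonarchimedean_local_field v + central_division_algebra smul + discretely_valued_division_ring w
  for v :: "'k::field \<Rightarrow> int" and smul :: "'k \<Rightarrow> 'b::division_ring \<Rightarrow> 'b" and w :: "'b \<Rightarrow> int" +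
  fixes e :: int
  assumes e_pos: "0 < e"
    and w_smul: "a \<noteq> 0 \<Longrightarrow> x \<noteq> 0 \<Longrightarrow> w (smul a x) = e * v a + w x"
    and integers_fg: "\<exists>F. finite F \<and> I 0 = int_span v smul F"
begin

sublocale mat: integral_vector_space v "mat2_scale smul"
  using vector_space_mat2_scale nonarchimedean_local_field_axioms
  by (simp add: integral_vector_space_def)

lemmas scale_mult = mat2_scale_mult[OF central_division_algebra_axioms]

definition M :: "int \<Rightarrow> ('b^2^2) set" where
  "M j = {A. \<forall>i k. A $ i $ k \<in> I j}"

lemma M_m2 [simp]: "m2 a b c d \<in> M j \<longleftrightarrow> a \<in> I j \<and> b \<in> I j \<and> c \<in> I j \<and> d \<in> I j"
  by (auto simp: M_def forall_2)

lemma M_add: "A \<in> M j \<Longrightarrow> B \<in> M j \<Longrightarrow> A + B \<in> M j"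
  by (auto simp: M_def intro: I_add)

lemma M_diff: "A \<in> M j \<Longrightarrow> B \<in> M j \<Longrightarrow> A - B \<in> M j"
  by (auto simp: M_def intro: I_diff)

lemma M_zero [simp]: "0 \<in> M j"
  by (auto simp: M_def)

lemma M_one [simp]: "mat 1 \<in> M 0"
  by (simp add: m2_one)

lemma M_mono: "A \<in> M j \<Longrightarrow> i \<le> j \<Longrightarrow> A \<in> M i"
  by (auto simp: M_def intro: I_mono)

lemma M_mult: "A \<in> M i \<Longrightarrow> B \<in> M j \<Longrightarrow> A ** B \<in> M (i + j)"
  by (cases A rule: m2_cases; cases B rule: m2_cases) (auto intro!: I_add I_mult)

lemma M_mult0: "A \<in> M 0 \<Longrightarrow> B \<in> M 0 \<Longrightarrow> A ** B \<in> M 0"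
  using M_mult[of A 0 B 0] by simp

lemma M_exhaust: "\<exists>j. A \<in> M j"
proof (cases A rule: m2_cases)
  case (1 a b c d)
  have "A \<in> M (min (min (w a) (w b)) (min (w c) (w d)))"
    by (auto simp: 1 I_def)
  then show ?thesis by blast
qed

lemma M_exhaust_finite: "finite F \<Longrightarrow> \<exists>j. F \<subseteq> M j"
proof (induction F rule: finite_induct)
  case (insert A F)
  then obtain i j where "F \<subseteq> M j" "A \<in> M i" using M_exhaust by blast
  then have "insert A F \<subseteq> M (min i j)"
    using M_mono[of _ i "min i j"] M_mono[of _ j "min i j"] by auto
  then show ?case by blast
qed simp

lemma I_smul: "a \<in> K.I i \<Longrightarrow> x \<in> I j \<Longrightarrow> smul a x \<in> I (e * i + j)"
  using e_pos by (cases "a = 0"; cases "x = 0")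
    (auto simp: I_def K.I_def w_smul intro!: add_mono)

lemma M_scale: "a \<in> K.I i \<Longrightarrow> A \<in> M j \<Longrightarrow> mat2_scale smul a A \<in> M (e * i + j)"
  by (auto simp: M_def mat2_scale_def intro: I_smul)

lemma M_scale0: "a \<in> K.I 0 \<Longrightarrow> A \<in> M j \<Longrightarrow> mat2_scale smul a A \<in> M j"
  using M_scale[of a 0] by simp

text \<open>For mutually inverse \<open>g\<close> and \<open>h\<close> this is
  \<open>g M_2(P^j) g^-1\<close>, written as a preimage so that membership is a condition on
  entries. For \<open>j = 0\<close> it is the stabiliser of the lattice
  \<open>g O^2\<close>.\<close>

definition Mc :: "'b^2^2 \<Rightarrow> 'b^2^2 \<Rightarrow> int \<Rightarrow> ('b^2^2) set" where
  "Mc g h j = {X. h ** X ** g \<in> M j}"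

lemma Mc_iff: "X \<in> Mc g h j \<longleftrightarrow> h ** X ** g \<in> M j"
  by (simp add: Mc_def)

lemma Mc_conj [simp]: "inv_pair g h \<Longrightarrow> g ** A ** h \<in> Mc g h j \<longleftrightarrow> A \<in> M j"
  by (simp add: Mc_iff conj_cancel)

lemma Mc_conjE:
  assumes "inv_pair g h" "X \<in> Mc g h j"
  obtains A where "A \<in> M j" "X = g ** A ** h"
proof (rule that)
  show "h ** X ** g \<in> M j" using assms by (simp add: Mc_iff)
  show "X = g ** (h ** X ** g) ** h" by (rule conj_cancel[OF inv_pair_sym[OF assms(1)], symmetric])
qed

lemma Mc_add: "X \<in> Mc g h j \<Longrightarrow> Y \<in> Mc g h j \<Longrightarrow> X + Y \<in> Mc g h j"
  by (simp add: Mc_iff matrix_add_ldistrib matrix_mul_add_left M_add)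

lemma Mc_diff: "X \<in> Mc g h j \<Longrightarrow> Y \<in> Mc g h j \<Longrightarrow> X - Y \<in> Mc g h j"
  by (simp add: Mc_iff matrix_mul_diff_right matrix_mul_diff_left M_diff)

lemma Mc_zero [simp]: "0 \<in> Mc g h j"
  by (simp add: Mc_iff)

lemma Mc_minus: "X \<in> Mc g h j \<Longrightarrow> - X \<in> Mc g h j"
  using Mc_diff[of 0 g h j X] by simp

lemma Mc_mono: "X \<in> Mc g h j \<Longrightarrow> i \<le> j \<Longrightarrow> X \<in> Mc g h i"
  by (auto simp: Mc_iff intro: M_mono)

lemma Mc_one: "inv_pair g h \<Longrightarrow> mat 1 \<in> Mc g h 0"
  by (simp add: Mc_iff)

lemma Mc_mult: "inv_pair g h \<Longrightarrow> X \<in> Mc g h i \<Longrightarrow> Y \<in> Mc g h j \<Longrightarrow> X ** Y \<in> Mc g h (i + j)"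
  by (simp add: Mc_iff conj_mult M_mult)

lemma Mc_scale0: "a \<in> K.I 0 \<Longrightarrow> X \<in> Mc g h j \<Longrightarrow> mat2_scale smul a X \<in> Mc g h j"
  by (simp add: Mc_iff scale_mult M_scale0)

lemma subring_Mc:
  assumes "inv_pair g h"
  shows "subring (Mc g h 0) mat2_ring"
proof -
  interpret R: ring "mat2_ring :: ('b^2^2) ring" by (rule ring_mat2_ring)
  show ?thesis
  proof (rule R.subringI)
    fix X Y assume "X \<in> Mc g h 0" "Y \<in> Mc g h 0"
    then show "X \<otimes>\<^bsub>mat2_ring\<^esub> Y \<in> Mc g h 0" "X \<oplus>\<^bsub>mat2_ring\<^esub> Y \<in> Mc g h 0"
      using Mc_mult[OF assms, of X 0 Y 0] by (simp_all add: mat2_ring_def Mc_add)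
  qed (use Mc_one[OF assms] in \<open>simp_all add: Mc_minus\<close>, simp_all add: mat2_ring_def)
qed

lemma is_order_alt: "is_order v smul H \<longleftrightarrow> subring H mat2_ring \<and>
    (\<exists>F. finite F \<and> H = int_span v (mat2_scale smul) F) \<and> module.span (mat2_scale smul) H = UNIV"
  by (simp add: is_order_def int_span_def)

text \<open>\<open>M_2(O)\<close> is generated by the four copies of a generating set of
  \<open>O\<close>, and it spans because every matrix becomes integral after scaling; conjugation
  respects both.\<close>

lemma is_order_Mc:
  assumes gh: "inv_pair g h"
  shows "is_order v smul (Mc g h 0)"
proof -
  obtain F0 where F0: "finite F0" "I 0 = int_span v smul F0" using integers_fg by blast
  interpret B: integral_vector_space v smul ..
  have F0I: "f \<in> I 0" if "f \<in> F0" for f using F0 B.int_span_base that by blast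
  define \<phi> where "\<phi> x = {m2 x 0 0 0, m2 0 x 0 0, m2 0 0 x 0, m2 0 0 0 x}" for x :: 'b
  define F where "F = (\<lambda>A. g ** A ** h) ` (\<Union>x\<in>F0. \<phi> x)"
  have F: "finite F" using F0 by (auto simp: F_def \<phi>_def)
  \<comment> \<open>\<open>f\<close> stands for one of the four embeddings of \<open>B\<close> as a
    matrix entry, so that one linearity argument serves for all of them.\<close>
  have gen: "g ** f x ** h \<in> int_span v (mat2_scale smul) F"
    if f: "\<And>x. f x \<in> \<phi> x" "\<And>x y. f (x + y) = f x + f y" "f 0 = 0"
      "\<And>a x. f (smul a x) = mat2_scale smul a (f x)" and x: "x \<in> I 0" for f x
  proof -
    obtain c where c: "x = (\<Sum>z\<in>F0. smul (c z) z)" "\<forall>z\<in>F0. c z \<in> K.I 0"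
      using x F0 by (auto simp: int_span_def integers_of_eq)
    have "f (\<Sum>z\<in>G. smul (c z) z) = (\<Sum>z\<in>G. mat2_scale smul (c z) (f z))" for G
      by (induction G rule: infinite_finite_induct) (simp_all add: f)
    moreover have "g ** (\<Sum>z\<in>G. mat2_scale smul (c z) (f z)) ** h =
        (\<Sum>z\<in>G. mat2_scale smul (c z) (g ** f z ** h))" for G
      by (induction G rule: infinite_finite_induct)
        (simp_all add: matrix_add_ldistrib matrix_mul_add_left scale_mult)
    ultimately have "g ** f x ** h = (\<Sum>z\<in>F0. mat2_scale smul (c z) (g ** f z ** h))"
      using c(1) by simp
    then show ?thesis
      using c(2) F f(1) by (auto intro!: mat.int_span_sum mat.int_span_scale simp: F_def)
  qed
  have "Mc g h 0 = int_span v (mat2_scale smul) F"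
  proof
    show "int_span v (mat2_scale smul) F \<subseteq> Mc g h 0"
      using F0I by (intro mat.int_span_subset) (auto simp: F_def \<phi>_def gh Mc_add Mc_scale0)
    show "Mc g h 0 \<subseteq> int_span v (mat2_scale smul) F"
    proof
      fix X assume "X \<in> Mc g h 0"
      then obtain A where A: "A \<in> M 0" "X = g ** A ** h" by (rule Mc_conjE[OF gh])
      obtain a b c d where abcd: "A = m2 a b c d" by (rule m2_cases)
      have "A = m2 a 0 0 0 + m2 0 b 0 0 + m2 0 0 c 0 + m2 0 0 0 d" by (simp add: abcd)
      then have "X = g ** m2 a 0 0 0 ** h + g ** m2 0 b 0 0 ** h + g ** m2 0 0 c 0 ** h + g ** m2 0 0 0 d ** h"
        unfolding A(2) by (simp only: matrix_add_ldistrib matrix_mul_add_left)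
      moreover have "g ** m2 a 0 0 0 ** h \<in> int_span v (mat2_scale smul) F"
        using A(1) by (intro gen[of "\<lambda>x. m2 x 0 0 0"]) (simp_all add: \<phi>_def abcd m2_zero)
      moreover have "g ** m2 0 b 0 0 ** h \<in> int_span v (mat2_scale smul) F"
        using A(1) by (intro gen[of "\<lambda>x. m2 0 x 0 0"]) (simp_all add: \<phi>_def abcd m2_zero)
      moreover have "g ** m2 0 0 c 0 ** h \<in> int_span v (mat2_scale smul) F"
        using A(1) by (intro gen[of "\<lambda>x. m2 0 0 x 0"]) (simp_all add: \<phi>_def abcd m2_zero)
      moreover have "g ** m2 0 0 0 d ** h \<in> int_span v (mat2_scale smul) F"
        using A(1) by (intro gen[of "\<lambda>x. m2 0 0 0 x"]) (simp_all add: \<phi>_def abcd m2_zero)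
      ultimately show "X \<in> int_span v (mat2_scale smul) F"
        by (simp add: mat.int_span_add)
    qed
  qed
  moreover have "X \<in> mat.span (Mc g h 0)" for X
  proof -
    obtain j where j: "h ** X ** g \<in> M j" using M_exhaust by blast
    obtain a where a: "a \<noteq> 0" "v a = \<bar>j\<bar>" using exists_valuation by blast
    have "mat2_scale smul a (h ** X ** g) \<in> M (e * \<bar>j\<bar> + j)"
      using a j by (intro M_scale) (simp_all add: K.I_def)
    \<comment> \<open>Since \<open>e\<close> is at least 1, a scalar of value
      \<open>\<bar>j\<bar>\<close> raises values in \<open>B\<close> by at least
      \<open>\<bar>j\<bar>\<close>.\<close>
    moreover have "1 * \<bar>j\<bar> \<le> e * \<bar>j\<bar>" using e_pos by (intro mult_right_mono) auto
    ultimately have "mat2_scale smul a X \<in> Mc g h 0"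
      by (auto simp: Mc_iff scale_mult elim!: M_mono)
    then have "mat2_scale smul (inverse a) (mat2_scale smul a X) \<in> mat.span (Mc g h 0)"
      by (intro mat.span_scale mat.span_base)
    then show ?thesis using a by simp
  qed
  ultimately show ?thesis using F subring_Mc[OF gh] by (auto simp: is_order_alt)
qed

lemma order_bounded:
  assumes "is_order v smul H"
  obtains j where "H \<subseteq> M j"
proof -
  obtain F where F: "finite F" "H = int_span v (mat2_scale smul) F"
    using assms by (auto simp: is_order_alt)
  obtain j where "F \<subseteq> M j" using M_exhaust_finite[OF F(1)] by blast
  then have "H \<subseteq> M j" unfolding F(2) by (intro mat.int_span_subset) (auto simp: M_add M_scale0)
  then show thesis by (rule that)
qed

lemma order_closed:
  assumes "is_order v smul H"
  shows "mat 1 \<in> H" "A \<in> H \<Longrightarrow> B \<in> H \<Longrightarrow> A ** B \<in> H" 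
proof -
  have "subring H mat2_ring" using assms by (simp add: is_order_alt)
  from subringE(3)[OF this] subringE(6)[OF this, of A B]
  show "mat 1 \<in> H" "A \<in> H \<Longrightarrow> B \<in> H \<Longrightarrow> A ** B \<in> H" by (simp_all add: mat2_ring_def)
qed

text \<open>Values on \<open>S\<close> are nonnegative, so \<open>nat\<close> loses nothing and the
  well-order of the naturals applies.\<close>

lemma minimal_valuation:
  assumes "S \<subseteq> I 0" "s \<in> S" "s \<noteq> 0"
  obtains t where "t \<in> S" "t \<noteq> 0" "\<And>x. x \<in> S \<Longrightarrow> x \<in> I (w t)"
proof -
  obtain t where t: "t \<in> S \<and> t \<noteq> 0" "\<And>x. x \<in> S \<and> x \<noteq> 0 \<Longrightarrow> nat (w t) \<le> nat (w x)"
    using ex_has_least_nat[of "\<lambda>x. x \<in> S \<and> x \<noteq> 0" s "\<lambda>x. nat (w x)"] assms by blast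
  have nn: "0 \<le> w x" if "x \<in> S" "x \<noteq> 0" for x using that assms by (auto simp: I_def)
  have "x \<in> I (w t)" if "x \<in> S" for x
    using t(2)[of x] nn[of x] nn[of t] t(1) that by (cases "x = 0") (auto simp: I_def)
  then show thesis using that t by blast
qed

text \<open>The lattice \<open>\<Lambda> = {u. \<forall>A\<in>H. A u \<in> O\<^sup>2}\<close> is stable under the order \<open>H\<close>; a triangular basis of it
  conjugates \<open>H\<close> into \<open>M\<^sub>2(O)\<close>.\<close>

lemma order_subset_Mc:
  assumes H: "is_order v smul H"
  obtains g h where "inv_pair g h" "H \<subseteq> Mc g h 0"
proof -
  define \<Lambda> where "\<Lambda> = {(x, y). \<forall>A\<in>H. A $ 1 $ 1 * x + A $ 1 $ 2 * y \<in> I 0 \<and> A $ 2 $ 1 * x + A $ 2 $ 2 * y \<in> I 0}"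
  have integral: "x \<in> I 0" "y \<in> I 0" if "(x, y) \<in> \<Lambda>" for x y
    using that order_closed(1)[OF H] by (auto simp: \<Lambda>_def m2_one)
  have diff: "(x - x', y - y') \<in> \<Lambda>" if "(x, y) \<in> \<Lambda>" "(x', y') \<in> \<Lambda>" for x y x' y'
  proof -
    have "a * (x - x') + b * (y - y') = (a * x + b * y) - (a * x' + b * y')" for a b :: 'b
      by (simp add: algebra_simps)
    then show ?thesis using that by (simp add: \<Lambda>_def I_diff)
  qed
  have rmult: "(x * z, y * z) \<in> \<Lambda>" if "(x, y) \<in> \<Lambda>" "z \<in> I 0" for x y z
  proof -
    have "a * (x * z) + b * (y * z) = (a * x + b * y) * z" for a b :: 'b
      by (simp add: algebra_simps)
    then show ?thesis using that by (simp add: \<Lambda>_def I_mult_integral_right)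
  qed
  have stable: "(A $ 1 $ 1 * x + A $ 1 $ 2 * y, A $ 2 $ 1 * x + A $ 2 $ 2 * y) \<in> \<Lambda>"
    if "(x, y) \<in> \<Lambda>" "A \<in> H" for x y A
  proof -
    have "C $ 1 $ 1 * (A $ 1 $ 1 * x + A $ 1 $ 2 * y) + C $ 1 $ 2 * (A $ 2 $ 1 * x + A $ 2 $ 2 * y) \<in> I 0 \<and>
        C $ 2 $ 1 * (A $ 1 $ 1 * x + A $ 1 $ 2 * y) + C $ 2 $ 2 * (A $ 2 $ 1 * x + A $ 2 $ 2 * y) \<in> I 0"
      if C: "C \<in> H" for C
    proof -
      obtain a b c d where A: "A = m2 a b c d" by (rule m2_cases)
      obtain a' b' c' d' where C': "C = m2 a' b' c' d'" by (rule m2_cases)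
      have "C ** A \<in> H" using order_closed(2)[OF H C \<open>A \<in> H\<close>] .
      then show ?thesis using \<open>(x, y) \<in> \<Lambda>\<close> by (auto simp: \<Lambda>_def A C' algebra_simps)
    qed
    then show ?thesis by (auto simp: \<Lambda>_def)
  qed
  obtain j where j: "H \<subseteq> M j" using order_bounded[OF H] .
  obtain u where u: "u \<noteq> 0" "w u = 1" using uniformiser by blast
  \<comment> \<open>The entries of matrices in \<open>H\<close> lie in \<open>P^j\<close>, so a
    factor of value \<open>\<bar>j\<bar>\<close> makes them integral. This puts nonzero vectors on
    both axes into \<open>\<Lambda>\<close>.\<close>
  define t where "t = u ^ nat \<bar>j\<bar>"
  have t: "t \<noteq> 0" "w t = \<bar>j\<bar>" using u by (auto simp: t_def w_power)
  have "a * t \<in> I 0" if "a \<in> I j" for a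
    using that t by (auto simp: I_mult_iff' elim: I_mono)
  then have t\<Lambda>: "(t, 0) \<in> \<Lambda>" "(0, t) \<in> \<Lambda>" using j by (auto simp: \<Lambda>_def M_def subset_iff)
  \<comment> \<open>Hermite form: \<open>p\<close> generates the part of \<open>\<Lambda>\<close> on
    the first axis, \<open>q\<close> the projection to the second coordinate, and
    \<open>(x, q)\<close> will lift \<open>q\<close>.\<close>
  obtain p where p: "(p, 0) \<in> \<Lambda>" "p \<noteq> 0" and p_min: "\<And>x. (x, 0) \<in> \<Lambda> \<Longrightarrow> x \<in> I (w p)"
  proof (rule minimal_valuation[of "{x. (x, 0) \<in> \<Lambda>}" t])
    show "{x. (x, 0) \<in> \<Lambda>} \<subseteq> I 0" using integral by auto
  qed (use t t\<Lambda> that in auto)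
  obtain q where q: "q \<in> {y. \<exists>x. (x, y) \<in> \<Lambda>}" "q \<noteq> 0"
    and q_min: "\<And>y. y \<in> {y. \<exists>x. (x, y) \<in> \<Lambda>} \<Longrightarrow> y \<in> I (w q)"
  proof (rule minimal_valuation[of "{y. \<exists>x. (x, y) \<in> \<Lambda>}" t])
    show "{y. \<exists>x. (x, y) \<in> \<Lambda>} \<subseteq> I 0" using integral by auto
  qed (use t t\<Lambda> that in auto)
  then obtain x where x: "(x, q) \<in> \<Lambda>" by blast
  have basis: "\<exists>r' s'. r' \<in> I 0 \<and> s' \<in> I 0 \<and> r = p * r' + x * s' \<and> s = q * s'" if rs: "(r, s) \<in> \<Lambda>" for r s
  proof -
    define s' where "s' = inverse q * s"
    have s': "s = q * s'" using q by (simp add: s'_def mult.assoc[symmetric])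
    have "s \<in> I (w q)" using rs q_min by blast
    then have "s' \<in> I 0" using q by (simp add: s' I_mult_iff)
    from diff[OF rs rmult[OF x this]] have *: "(r - x * s', 0) \<in> \<Lambda>" by (simp add: s')
    define r' where "r' = inverse p * (r - x * s')"
    have r': "r - x * s' = p * r'" using p by (simp add: r'_def mult.assoc[symmetric])
    have "r' \<in> I 0" using p_min[OF *] p unfolding r' by (simp add: I_mult_iff)
    then show ?thesis using r' s' \<open>s' \<in> I 0\<close> by (metis add.commute diff_add_cancel)
  qed
  define g where "g = m2 p x 0 q"
  obtain h where gh: "inv_pair g h" using inv_pair_upper[OF p(2) q(2)] by (auto simp: g_def)
  have "A \<in> Mc g h 0" if A: "A \<in> H" for A
  proof -
    obtain a b c d where A': "A = m2 a b c d" by (rule m2_cases)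
    obtain r1 s1 where 1: "r1 \<in> I 0" "s1 \<in> I 0" "a * p = p * r1 + x * s1" "c * p = q * s1"
      using basis[OF stable[OF p(1) A]] by (auto simp: A')
    obtain r2 s2 where 2: "r2 \<in> I 0" "s2 \<in> I 0" "a * x + b * q = p * r2 + x * s2" "c * x + d * q = q * s2"
      using basis[OF stable[OF x A]] by (auto simp: A')
    \<comment> \<open>Stability of \<open>\<Lambda>\<close> expresses the images of the two basis
      columns in the same basis with integral coefficients.\<close>
    have "A ** g = g ** m2 r1 r2 s1 s2" using 1 2 by (simp add: A' g_def)
    then have "h ** A ** g = h ** g ** m2 r1 r2 s1 s2" by (simp add: matrix_mul_assoc[symmetric])
    then show ?thesis using 1 2 gh by (simp add: Mc_iff)
  qed
  then show thesis using that gh by blast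
qed

text \<open>Matrix units bring every entry of \<open>h ** X ** g\<close> to the top left corner
  inside the larger order. Its powers stay in that order, which is bounded, so the entry is
  integral.\<close>

lemma Mc_maximal:
  assumes gh: "inv_pair g h" and D: "is_order v smul D" "Mc g h 0 \<subseteq> D"
  shows "D = Mc g h 0"
proof (rule antisym[OF _ D(2)], rule subsetI)
  fix X assume X: "X \<in> D"
  have closed: "g ** (A ** B) ** h \<in> D" if "g ** A ** h \<in> D" "g ** B ** h \<in> D" for A B
    using order_closed(2)[OF D(1) that] conj_mult[OF inv_pair_sym[OF gh], of A B] by simp
  obtain a b c d where abcd: "h ** X ** g = m2 a b c d" by (rule m2_cases)
  have X': "g ** m2 a b c d ** h \<in> D"
    using X conj_cancel[OF inv_pair_sym[OF gh], of X] by (simp add: abcd)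
  have unit: "g ** A ** h \<in> D" if "A \<in> M 0" for A using D(2) gh that by auto
  have corner: "g ** m2 y 0 0 0 ** h \<in> D" if "y \<in> {a, b, c, d}" for y
  proof -
    have *: "g ** (A ** m2 a b c d ** B) ** h \<in> D" if "A \<in> M 0" "B \<in> M 0" for A B
      using that by (intro closed unit X')
    have "g ** m2 a 0 0 0 ** h \<in> D" using *[of "m2 1 0 0 0" "m2 1 0 0 0"] by simp
    moreover have "g ** m2 b 0 0 0 ** h \<in> D" using *[of "m2 1 0 0 0" "m2 0 0 1 0"] by simp
    moreover have "g ** m2 c 0 0 0 ** h \<in> D" using *[of "m2 0 1 0 0" "m2 1 0 0 0"] by simp
    moreover have "g ** m2 d 0 0 0 ** h \<in> D" using *[of "m2 0 1 0 0" "m2 0 0 1 0"] by simp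
    ultimately show ?thesis using that by auto
  qed
  obtain i where i: "D \<subseteq> M i" using order_bounded[OF D(1)] .
  obtain k l where k: "g \<in> M k" and l: "h \<in> M l" using M_exhaust by metis
  have "y \<in> I 0" if y: "y \<in> {a, b, c, d}" for y
  proof (cases "y = 0")
    case False
    have "y ^ m \<in> I (l + i + k)" for m
    proof -
      have "g ** m2 (y ^ m) 0 0 0 ** h \<in> D"
      proof (induction m)
        case 0
        show ?case by (rule unit) simp
      next
        case (Suc m)
        from closed[OF corner[OF y] this] show ?case by simp
      qed
      then have "h ** (g ** m2 (y ^ m) 0 0 0 ** h) ** g \<in> M (l + i + k)"
        using i k l by (intro M_mult) auto
      then show ?thesis by (simp add: conj_cancel[OF gh])
    qed
    then have "0 \<le> w y" by (intro w_ge_if_powers_ge[OF False, of 0 "- (l + i + k)"]) (simp only: mult_zero_right diff_0 minus_minus)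
    then show ?thesis by (simp add: I_def)
  qed simp
  then show "X \<in> Mc g h 0" by (simp add: Mc_iff abcd)
qed

text \<open>Each order lies in some \<open>Mc g h 0\<close>, and these are orders that no order
  properly contains.\<close>

theorem maximal_order_iff: "is_maximal_order v smul D \<longleftrightarrow> (\<exists>g h. inv_pair g h \<and> D = Mc g h 0)"
proof
  assume D: "is_maximal_order v smul D"
  then obtain g h where "inv_pair g h" "D \<subseteq> Mc g h 0"
    by (auto simp: is_maximal_order_def elim: order_subset_Mc)
  then show "\<exists>g h. inv_pair g h \<and> D = Mc g h 0"
    using D is_order_Mc unfolding is_maximal_order_def by metis
next
  assume "\<exists>g h. inv_pair g h \<and> D = Mc g h 0"
  then show "is_maximal_order v smul D"
    using is_order_Mc Mc_maximal unfolding is_maximal_order_def by metis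
qed


section \<open>Two-sided ideals of a maximal order\<close>

lemma ring_Mc: "inv_pair g h \<Longrightarrow> ring (mat2_subring (Mc g h 0))"
  using ring.subring_is_ring[OF ring_mat2_ring subring_Mc] .

lemma minus_Mc:
  assumes "inv_pair g h" "X \<in> Mc g h 0"
  shows "\<ominus>\<^bsub>mat2_subring (Mc g h 0)\<^esub> X = - X"
proof -
  interpret R: ring "mat2_subring (Mc g h 0)" by (rule ring_Mc[OF assms(1)])
  show ?thesis by (rule R.minus_equality) (use assms in \<open>simp_all add: Mc_minus\<close>)
qed

lemma ideal_Mc:
  assumes gh: "inv_pair g h" and j: "0 \<le> j"
  shows "ideal (Mc g h j) (mat2_subring (Mc g h 0))"
proof (rule idealI[OF ring_Mc[OF gh]])
  interpret R: ring "mat2_subring (Mc g h 0)" by (rule ring_Mc[OF gh])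
  have sub: "Mc g h j \<subseteq> Mc g h 0" using j by (auto elim: Mc_mono)
  show "subgroup (Mc g h j) (add_monoid (mat2_subring (Mc g h 0)))"
  proof (rule R.add.subgroupI)
    show "Mc g h j \<subseteq> carrier (mat2_subring (Mc g h 0))" using sub by simp
    show "\<ominus>\<^bsub>mat2_subring (Mc g h 0)\<^esub> X \<in> Mc g h j" if "X \<in> Mc g h j" for X
      using that sub minus_Mc[OF gh, of X] by (auto simp: Mc_minus)
    show "Mc g h j \<noteq> {}" using Mc_zero[of g h j] by blast
  qed (simp add: Mc_add)
  fix A X assume "A \<in> Mc g h j" "X \<in> carrier (mat2_subring (Mc g h 0))"
  then show "X \<otimes>\<^bsub>mat2_subring (Mc g h 0)\<^esub> A \<in> Mc g h j" "A \<otimes>\<^bsub>mat2_subring (Mc g h 0)\<^esub> X \<in> Mc g h j"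
    using Mc_mult[OF gh, of X 0 A j] Mc_mult[OF gh, of A j X 0] by simp_all
qed

text \<open>An ideal element outside \<open>Mc g h 1\<close> has, after conjugation, a unit entry.
  Matrix units on both sides and the inverse of that entry yield both diagonal idempotents, whose
  sum is 1.\<close>

lemma proper_ideal_Mc:
  assumes gh: "inv_pair g h" and J: "ideal J (mat2_subring (Mc g h 0))" "J \<noteq> Mc g h 0"
  shows "J \<subseteq> Mc g h 1"
proof (rule ccontr)
  interpret J: ideal J "mat2_subring (Mc g h 0)" by (rule J(1))
  assume "\<not> J \<subseteq> Mc g h 1"
  then obtain X where X: "X \<in> J" "X \<notin> Mc g h 1" by blast
  then have "X \<in> Mc g h 0" using J.a_subset by auto
  then obtain A where A: "A \<in> M 0" "X = g ** A ** h" by (rule Mc_conjE[OF gh])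
  obtain a b c d where abcd: "A = m2 a b c d" by (rule m2_cases)
  obtain y where y: "y \<in> {a, b, c, d}" "y \<notin> I 1" using X A abcd gh by auto
  then have y0: "y \<noteq> 0" "w y = 0" using A(1) by (auto simp: abcd I_def)
  then have iy: "inverse y \<in> I 0" by (simp add: I_def w_inverse)
  have sand: "g ** (S ** A ** T) ** h \<in> J" if "S \<in> M 0" "T \<in> M 0" for S T
  proof -
    have "(g ** S ** h) ** X ** (g ** T ** h) \<in> J"
      using J.I_l_closed[of X "g ** S ** h"] J.I_r_closed[of "(g ** S ** h) ** X" "g ** T ** h"] X that gh
      by simp
    moreover have "(g ** S ** h) ** X ** (g ** T ** h) = g ** (S ** A ** T) ** h"
      using conj_mult[OF inv_pair_sym[OF gh]] by (simp only: A(2))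
    ultimately show ?thesis by simp
  qed
  have "g ** m2 1 0 0 0 ** h \<in> J \<and> g ** m2 0 0 0 1 ** h \<in> J"
  proof -
    consider "y = a" | "y = b" | "y = c" | "y = d" using y by blast
    then show ?thesis
    proof cases
      case 1
      then show ?thesis using sand[of "m2 (inverse y) 0 0 0" "m2 1 0 0 0"] sand[of "m2 0 0 (inverse y) 0" "m2 0 1 0 0"] iy y0
        by (simp add: abcd)
    next
      case 2
      then show ?thesis using sand[of "m2 (inverse y) 0 0 0" "m2 0 0 1 0"] sand[of "m2 0 0 (inverse y) 0" "m2 0 0 0 1"] iy y0
        by (simp add: abcd)
    next
      case 3
      then show ?thesis using sand[of "m2 0 (inverse y) 0 0" "m2 1 0 0 0"] sand[of "m2 0 0 0 (inverse y)" "m2 0 1 0 0"] iy y0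
        by (simp add: abcd)
    next
      case 4
      then show ?thesis using sand[of "m2 0 (inverse y) 0 0" "m2 0 0 1 0"] sand[of "m2 0 0 0 (inverse y)" "m2 0 0 0 1"] iy y0
        by (simp add: abcd)
    qed
  qed
  then have "g ** m2 1 0 0 0 ** h + g ** m2 0 0 0 1 ** h \<in> J"
    using additive_subgroup.a_closed[OF J.additive_subgroup_axioms, of "g ** m2 1 0 0 0 ** h" "g ** m2 0 0 0 1 ** h"] by simp
  also have "g ** m2 1 0 0 0 ** h + g ** m2 0 0 0 1 ** h = g ** (m2 1 0 0 0 + m2 0 0 0 1) ** h"
    by (simp only: matrix_add_ldistrib matrix_mul_add_left)
  also have "\<dots> = mat 1" using gh by (simp flip: m2_one)
  finally have "J = Mc g h 0" using J.one_imp_carrier by simp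
  then show False using J(2) by simp
qed

text \<open>All proper ideals lie in \<open>Mc g h 1\<close>, itself a proper ideal, so it is the
  only maximal one and \<open>THE\<close> picks it.\<close>

lemma max_ideal_Mc:
  assumes gh: "inv_pair g h"
  shows "max_ideal (Mc g h 0) = Mc g h 1"
  unfolding max_ideal_def
proof (rule the_equality)
  have ne: "Mc g h 0 \<noteq> Mc g h 1"
  proof
    assume "Mc g h 0 = Mc g h 1"
    then have "mat 1 \<in> Mc g h 1" using Mc_one[OF gh] by simp
    then have "mat 1 \<in> M 1" using gh by (simp add: Mc_iff)
    then show False by (simp add: m2_one one_notin_I)
  qed
  show max: "maximalideal (Mc g h 1) (mat2_subring (Mc g h 0))"
  proof (rule maximalidealI)
    show "ideal (Mc g h 1) (mat2_subring (Mc g h 0))" by (rule ideal_Mc[OF gh]) simp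
    show "carrier (mat2_subring (Mc g h 0)) \<noteq> Mc g h 1" using ne by simp
    fix J assume "ideal J (mat2_subring (Mc g h 0))" "Mc g h 1 \<subseteq> J"
    then show "J = Mc g h 1 \<or> J = carrier (mat2_subring (Mc g h 0))"
      using proper_ideal_Mc[OF gh, of J] by auto
  qed
  fix J assume J: "maximalideal J (mat2_subring (Mc g h 0))"
  interpret J: maximalideal J "mat2_subring (Mc g h 0)" by (rule J)
  have "J \<subseteq> Mc g h 1"
    using proper_ideal_Mc[OF gh J.is_ideal] J.I_notcarr by auto
  moreover have "Mc g h 1 \<subseteq> Mc g h 0" by (auto elim: Mc_mono)
  ultimately show "J = Mc g h 1"
    using J.I_maximal[of "Mc g h 1"] ideal_Mc[OF gh, of 1] ne by auto
qed

text \<open>A matrix over \<open>P^2\<close> is the scalar matrix of a uniformiser times a matrix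
  over \<open>P\<close>, so even a single product suffices; the other inclusion adds values.\<close>

lemma max_ideal_sq_Mc:
  assumes gh: "inv_pair g h"
  shows "max_ideal_sq (Mc g h 0) = Mc g h 2"
  unfolding max_ideal_sq_def max_ideal_Mc[OF gh]
proof
  show "ideal_prod (mat2_subring (Mc g h 0)) (Mc g h 1) (Mc g h 1) \<subseteq> Mc g h 2"
  proof
    fix X assume "X \<in> ideal_prod (mat2_subring (Mc g h 0)) (Mc g h 1) (Mc g h 1)"
    then show "X \<in> Mc g h 2"
    proof induction
      case (prod X Y)
      then show ?case using Mc_mult[OF gh, of X 1 Y 1] by simp
    qed (simp add: Mc_add)
  qed
  show "Mc g h 2 \<subseteq> ideal_prod (mat2_subring (Mc g h 0)) (Mc g h 1) (Mc g h 1)"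
  proof
    fix X assume "X \<in> Mc g h 2"
    then obtain A where A: "A \<in> M 2" "X = g ** A ** h" by (rule Mc_conjE[OF gh])
    obtain p where p: "p \<noteq> 0" "w p = 1" using uniformiser by blast
    obtain a b c d where abcd: "A = m2 a b c d" by (rule m2_cases)
    have eq: "A = m2 p 0 0 p ** m2 (inverse p * a) (inverse p * b) (inverse p * c) (inverse p * d)"
      using p by (simp add: abcd mult.assoc[symmetric])
    have "X = (g ** m2 p 0 0 p ** h) ** (g ** m2 (inverse p * a) (inverse p * b) (inverse p * c) (inverse p * d) ** h)"
      unfolding A(2) conj_mult[OF inv_pair_sym[OF gh], symmetric] eq ..
    moreover have "g ** m2 p 0 0 p ** h \<in> Mc g h 1" using gh p by (simp add: I_def)
    moreover have "g ** m2 (inverse p * a) (inverse p * b) (inverse p * c) (inverse p * d) ** h \<in> Mc g h 1"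
      using gh p A(1) by (simp add: abcd I_mult_iff w_inverse)
    ultimately show "X \<in> ideal_prod (mat2_subring (Mc g h 0)) (Mc g h 1) (Mc g h 1)"
      using ideal_prod.prod[of _ "Mc g h 1" _ "Mc g h 1" "mat2_subring (Mc g h 0)"] by simp
  qed
qed

text \<open>Cosets agree exactly if their representatives differ by an element of the square, so
  centrality in the quotient becomes a condition on commutators.\<close>

lemma order_sq_Mc:
  assumes gh: "inv_pair g h"
  shows "order_sq (Mc g h 0) = {X \<in> Mc g h 0. \<forall>Y\<in>Mc g h 0. X ** Y - Y ** X \<in> Mc g h 2}"
proof -
  interpret R: ring "mat2_subring (Mc g h 0)" by (rule ring_Mc[OF gh])
  interpret J: ideal "Mc g h 2" "mat2_subring (Mc g h 0)" by (rule ideal_Mc[OF gh]) simp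
  let ?R = "mat2_subring (Mc g h 0)"
  have mult: "X ** Y \<in> Mc g h 0" if "X \<in> Mc g h 0" "Y \<in> Mc g h 0" for X Y
    using Mc_mult[OF gh that] by simp
  have eq: "Mc g h 2 +>\<^bsub>?R\<^esub> X = Mc g h 2 +>\<^bsub>?R\<^esub> Y \<longleftrightarrow> X - Y \<in> Mc g h 2"
    if "X \<in> Mc g h 0" "Y \<in> Mc g h 0" for X Y
    using R.quotient_eq_iff_same_a_r_cos[OF J.is_ideal, of X Y] that
    by (simp add: a_minus_def minus_Mc[OF gh])
  have "Mc g h 2 +>\<^bsub>?R\<^esub> X \<in> ring_center (?R Quot Mc g h 2) \<longleftrightarrow>
      (\<forall>Y\<in>Mc g h 0. X ** Y - Y ** X \<in> Mc g h 2)" if X: "X \<in> Mc g h 0" for X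
  proof -
    have "Mc g h 2 +>\<^bsub>?R\<^esub> X \<in> ring_center (?R Quot Mc g h 2) \<longleftrightarrow>
      (\<forall>Y\<in>Mc g h 0. rcoset_mult ?R (Mc g h 2) (Mc g h 2 +>\<^bsub>?R\<^esub> X) (Mc g h 2 +>\<^bsub>?R\<^esub> Y) =
        rcoset_mult ?R (Mc g h 2) (Mc g h 2 +>\<^bsub>?R\<^esub> Y) (Mc g h 2 +>\<^bsub>?R\<^esub> X))"
      using X by (simp add: ring_center_def carrier_Quot mult_Quot)
    also have "\<dots> \<longleftrightarrow> (\<forall>Y\<in>Mc g h 0. Mc g h 2 +>\<^bsub>?R\<^esub> (X ** Y) = Mc g h 2 +>\<^bsub>?R\<^esub> (Y ** X))"
      using X J.rcoset_mult_add by simp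
    also have "\<dots> \<longleftrightarrow> (\<forall>Y\<in>Mc g h 0. X ** Y - Y ** X \<in> Mc g h 2)"
      using X by (simp add: eq mult)
    finally show ?thesis .
  qed
  then show ?thesis by (auto simp: order_sq_def max_ideal_sq_Mc[OF gh])
qed

section \<open>Description of D^[2] by lattice stabilisers\<close>

text \<open>The test matrices are one diagonal idempotent and those with a single lower left entry.
  The last condition packs two: \<open>x = 1\<close> gives \<open>a\<close> congruent to
  \<open>d\<close>, and then \<open>a\<close> is central modulo \<open>P^2\<close>. In this form it
  matches the stabilisers of lattices through \<open>(1, x)\<close>.\<close>

lemma central_mod_square_iff:
  assumes A: "m2 a b c d \<in> M 0"
  shows "(\<forall>Z\<in>M 0. m2 a b c d ** Z - Z ** m2 a b c d \<in> M 2) \<longleftrightarrow>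
    b \<in> I 2 \<and> c \<in> I 2 \<and> (\<forall>x\<in>I 0. d * x - x * a \<in> I 2)" (is "?L \<longleftrightarrow> ?R")
proof
  assume L: ?L
  from L[THEN bspec, of "m2 1 0 0 0"] have "b \<in> I 2" "c \<in> I 2" by auto
  moreover have "d * x - x * a \<in> I 2" if "x \<in> I 0" for x
    using L[THEN bspec, of "m2 0 0 x 0"] that by auto
  ultimately show ?R by blast
next
  assume R: ?R
  have 1: "a - d \<in> I 2" using R I_diff_commute[of a d] by (auto dest: bspec[of _ _ 1])
  show ?L
  proof
    fix Z assume Z: "Z \<in> M 0"
    obtain p q r s where Z': "Z = m2 p q r s" by (rule m2_cases)
    have z: "p \<in> I 0" "q \<in> I 0" "r \<in> I 0" "s \<in> I 0" using Z by (auto simp: Z')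
    have comm: "a * x - x * a \<in> I 2" "a * x - x * d \<in> I 2" "d * x - x * d \<in> I 2" "d * x - x * a \<in> I 2"
      if x: "x \<in> I 0" for x
    proof -
      have dx: "d * x - x * a \<in> I 2" using R x by blast
      have ax: "(a - d) * x \<in> I 2" "x * (a - d) \<in> I 2"
        using 1 x by (auto intro: I_mult_integral_left I_mult_integral_right)
      have "a * x - x * a = (a - d) * x + (d * x - x * a)" by (simp add: algebra_simps)
      then show ca: "a * x - x * a \<in> I 2" using I_add[OF ax(1) dx] by (simp only:)
      have "a * x - x * d = (a * x - x * a) + x * (a - d)" by (simp add: algebra_simps)
      then show "a * x - x * d \<in> I 2" using I_add[OF ca ax(2)] by (simp only:)
      have "d * x - x * d = (d * x - x * a) + x * (a - d)" by (simp add: algebra_simps)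
      then show "d * x - x * d \<in> I 2" using I_add[OF dx ax(2)] by (simp only:)
      show "d * x - x * a \<in> I 2" by (rule dx)
    qed
    have bc: "b * x \<in> I 2" "c * x \<in> I 2" "x * b \<in> I 2" "x * c \<in> I 2" if "x \<in> I 0" for x
      using R that by (auto intro: I_mult_integral_left I_mult_integral_right)
    have eqs: "(a * p + b * r) - (p * a + q * c) = (a * p - p * a) + (b * r - q * c)"
      "(a * q + b * s) - (p * b + q * d) = (a * q - q * d) + (b * s - p * b)"
      "(c * p + d * r) - (r * a + s * c) = (d * r - r * a) + (c * p - s * c)"
      "(c * q + d * s) - (r * b + s * d) = (d * s - s * d) + (c * q - r * b)"
      by (simp_all add: algebra_simps)
    show "m2 a b c d ** Z - Z ** m2 a b c d \<in> M 2"
      unfolding Z' m2_mult m2_diff M_m2 eqs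
      using I_add[OF comm(1)[OF z(1)] I_diff[OF bc(1)[OF z(3)] bc(4)[OF z(2)]]]
        I_add[OF comm(2)[OF z(2)] I_diff[OF bc(1)[OF z(4)] bc(3)[OF z(1)]]]
        I_add[OF comm(4)[OF z(3)] I_diff[OF bc(2)[OF z(1)] bc(4)[OF z(4)]]]
        I_add[OF comm(3)[OF z(4)] I_diff[OF bc(2)[OF z(2)] bc(3)[OF z(3)]]]
      by blast
  qed
qed

lemma order_sq_Mc_iff:
  assumes gh: "inv_pair g h" and X: "h ** X ** g = m2 a b c d"
  shows "X \<in> order_sq (Mc g h 0) \<longleftrightarrow>
    m2 a b c d \<in> M 0 \<and> b \<in> I 2 \<and> c \<in> I 2 \<and> (\<forall>x\<in>I 0. d * x - x * a \<in> I 2)"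
proof -
  have eq: "h ** (X ** Y - Y ** X) ** g = m2 a b c d ** (h ** Y ** g) - (h ** Y ** g) ** m2 a b c d" for Y
    by (simp only: matrix_mul_diff_right matrix_mul_diff_left conj_mult[OF gh] X)
  have "(\<forall>Y\<in>Mc g h 0. X ** Y - Y ** X \<in> Mc g h 2) \<longleftrightarrow>
      (\<forall>Z\<in>M 0. m2 a b c d ** Z - Z ** m2 a b c d \<in> M 2)"
    (is "?l \<longleftrightarrow> ?r")
  proof (intro iffI ballI)
    fix Z assume l: ?l and Z: "Z \<in> M 0"
    then have "X ** (g ** Z ** h) - (g ** Z ** h) ** X \<in> Mc g h 2" using gh by simp
    then show "m2 a b c d ** Z - Z ** m2 a b c d \<in> M 2"
      unfolding Mc_iff eq by (simp only: conj_cancel[OF gh])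
  next
    fix Y assume r: ?r and Y: "Y \<in> Mc g h 0"
    then show "X ** Y - Y ** X \<in> Mc g h 2" unfolding Mc_iff eq by blast
  qed
  then show ?thesis
    using central_mod_square_iff[of a b c d] by (auto simp: order_sq_Mc[OF gh] Mc_iff X)
qed

text \<open>In the basis \<open>g\<close>, the family consists of the order itself and the
  stabilisers of the lattices spanned by \<open>(p, 0)\<close>, \<open>(0, 1)\<close> and by
  \<open>(1, x)\<close>, \<open>(0, p)\<close>, where \<open>p\<close> has value 2 and
  \<open>x\<close> runs over representatives of \<open>O/P^2\<close>. The former lattice forces
  \<open>b\<close> into \<open>P^2\<close>, the latter ones
  \<open>c + d * x - x * a - x * b * x\<close>.\<close>

lemma order_sq_is_intersection:
  assumes gh: "inv_pair g h"
  shows "\<exists>F. finite F \<and> F \<noteq> {} \<and> (\<forall>D'\<in>F. is_maximal_order v smul D') \<and> order_sq (Mc g h 0) = \<Inter>F"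
proof -
  obtain R where R: "finite R" "R \<subseteq> I 0" "\<And>x. x \<in> I 0 \<Longrightarrow> \<exists>r\<in>R. x - r \<in> I 2"
    using finite_quotients[of 2] by blast
  obtain u where u: "u \<noteq> 0" "w u = 1" using uniformiser by blast
  define p where "p = u ^ 2"
  have p: "p \<noteq> 0" "w p = 2" using u by (auto simp: p_def w_power)
  define s where "s x = m2 1 0 x p" for x
  define s' where "s' x = m2 1 0 (- (inverse p * x)) (inverse p)" for x
  have s: "inv_pair (s x) (s' x)" for x using p by (simp add: inv_pair_def s_def s'_def m2_one mult.assoc[symmetric])
  define t where "t = m2 p 0 0 1"
  define t' where "t' = m2 (inverse p) 0 0 1"
  have t: "inv_pair t t'" using p by (simp add: inv_pair_def t_def t'_def m2_one)
  define F where "F = insert (Mc g h 0) (insert (Mc (g ** t) (t' ** h) 0) ((\<lambda>x. Mc (g ** s x) (s' x ** h) 0) ` R))"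
  have "X \<in> order_sq (Mc g h 0) \<longleftrightarrow> X \<in> \<Inter>F" for X
  proof -
    obtain a b c d where abcd: "h ** X ** g = m2 a b c d" by (rule m2_cases)
    show ?thesis
    proof (cases "m2 a b c d \<in> M 0")
      case False
      then show ?thesis using abcd by (auto simp: order_sq_Mc_iff[OF gh abcd] F_def Mc_iff)
    next
      case True
      then have I0: "a \<in> I 0" "b \<in> I 0" "c \<in> I 0" "d \<in> I 0" by auto
      have tX: "X \<in> Mc (g ** t) (t' ** h) 0 \<longleftrightarrow> b \<in> I 2"
      proof -
        have "(t' ** h) ** X ** (g ** t) = t' ** m2 a b c d ** t"
          by (simp add: abcd[symmetric] matrix_mul_assoc)
        also have "\<dots> = m2 (inverse p * a * p) (inverse p * b) (c * p) d" by (simp add: t_def t'_def)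
        finally show ?thesis
          using I0 p by (auto simp: Mc_iff I_prod_conj I_mult_iff w_inverse I_mult_iff' elim: I_mono)
      qed
      have sX: "X \<in> Mc (g ** s x) (s' x ** h) 0 \<longleftrightarrow> c + d * x - x * a - x * b * x \<in> I 2" if x: "x \<in> I 0" for x
      proof -
        have "(s' x ** h) ** X ** (g ** s x) = s' x ** m2 a b c d ** s x"
          by (simp add: abcd[symmetric] matrix_mul_assoc)
        also have "\<dots> = m2 (a + b * x) (b * p) (inverse p * (c + d * x - x * a - x * b * x)) (inverse p * (d - x * b) * p)"
          by (simp add: s_def s'_def algebra_simps)
        finally have eq: "(s' x ** h) ** X ** (g ** s x) = \<dots>" .
        have "a + b * x \<in> I 0" "b * p \<in> I 0" "d - x * b \<in> I 0"
          using I0 x p by (auto intro!: I_add I_diff intro: I_mult_integral_left simp: I_mult_iff' elim: I_mono)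
        then show ?thesis
          using p unfolding Mc_iff eq M_m2 I_prod_conj[OF p(1)] by (simp add: I_mult_iff w_inverse)
      qed
      show ?thesis
      proof
        assume "X \<in> order_sq (Mc g h 0)"
        then have *: "b \<in> I 2" "c \<in> I 2" "\<And>x. x \<in> I 0 \<Longrightarrow> d * x - x * a \<in> I 2"
          by (auto simp: order_sq_Mc_iff[OF gh abcd])
        have "c + d * x - x * a - x * b * x \<in> I 2" if "x \<in> I 0" for x
        proof -
          have "c + d * x - x * a - x * b * x = c + (d * x - x * a) - x * b * x" by simp
          moreover have "x * b * x \<in> I 2" using * that by (intro I_mult_integral_right I_mult_integral_left)
          ultimately show ?thesis using * that by (simp only: I_add I_diff)
        qed
        then show "X \<in> \<Inter>F" using True abcd * tX sX R(2) by (auto simp: F_def Mc_iff[of _ g h])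
      next
        assume "X \<in> \<Inter>F"
        then have b: "b \<in> I 2" and r: "\<And>r. r \<in> R \<Longrightarrow> c + d * r - r * a - r * b * r \<in> I 2"
          using tX sX R(2) by (auto simp: F_def)
        have r': "c + (d * r - r * a) \<in> I 2" if "r \<in> R" for r
        proof -
          have "r * b * r \<in> I 2" using b that R(2) by (intro I_mult_integral_right I_mult_integral_left) auto
          from I_add[OF r[OF that] this] show ?thesis by (simp add: algebra_simps)
        qed
        \<comment> \<open>Changing \<open>x\<close> by an element of \<open>P^2\<close> changes the
          expression by an element of \<open>P^2\<close>, so the representatives in \<open>R\<close>
          decide the condition for all integers.\<close>
        have x': "c + (d * x - x * a) \<in> I 2" if x: "x \<in> I 0" for x
        proof -
          obtain r where r: "r \<in> R" "x - r \<in> I 2" using R x by blast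
          have "c + (d * x - x * a) = (c + (d * r - r * a)) + (d * (x - r) - (x - r) * a)"
            by (simp add: algebra_simps)
          moreover have "d * (x - r) - (x - r) * a \<in> I 2"
            by (intro I_diff[OF I_mult_integral_left[OF I0(4) r(2)] I_mult_integral_right[OF r(2) I0(1)]])
          ultimately show ?thesis using r'[OF r(1)] by (simp only: I_add)
        qed
        \<comment> \<open>At \<open>x = 0\<close> the condition isolates \<open>c\<close>;
          subtracting it leaves the centrality condition.\<close>
        have c: "c \<in> I 2" using x'[of 0] by simp
        have "d * x - x * a \<in> I 2" if "x \<in> I 0" for x
          using I_diff[OF x'[OF that] c] by simp
        then show "X \<in> order_sq (Mc g h 0)" using True b c by (simp add: order_sq_Mc_iff[OF gh abcd])
      qed
    qed
  qed
  moreover have "is_maximal_order v smul D'" if "D' \<in> F" for D'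
    using that inv_pair_mult[OF gh t] inv_pair_mult[OF gh s] gh
    unfolding maximal_order_iff F_def by blast
  moreover have "finite F" "F \<noteq> {}" using R by (auto simp: F_def)
  ultimately show ?thesis by (intro exI[of _ F]) blast
qed

section \<open>Cartan and Iwasawa decompositions\<close>

text \<open>This is \<open>GL_2(O)\<close>; multiplying \<open>g\<close> by it on the right does not
  change the lattice \<open>g O^2\<close>.\<close>

definition GLO :: "('b^2^2) set" where
  "GLO = {k \<in> M 0. \<exists>k'\<in>M 0. inv_pair k k'}"

lemma GLO_I: "k \<in> M 0 \<Longrightarrow> k' \<in> M 0 \<Longrightarrow> inv_pair k k' \<Longrightarrow> k \<in> GLO"
  by (auto simp: GLO_def)

lemma GLO_mult:
  assumes "k \<in> GLO" "l \<in> GLO"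
  shows "k ** l \<in> GLO"
proof -
  obtain k' l' where "k' \<in> M 0" "inv_pair k k'" "l' \<in> M 0" "inv_pair l l'"
    using assms by (auto simp: GLO_def)
  then show ?thesis using assms
    by (intro GLO_I[of _ "l' ** k'"] inv_pair_mult M_mult0) (auto simp: GLO_def)
qed

lemma GLO_swap: "m2 0 1 1 0 \<in> GLO"
  by (rule GLO_I[OF _ _ inv_pair_swap]) simp_all

lemma GLO_lower: "x \<in> I 0 \<Longrightarrow> m2 1 0 x 1 \<in> GLO"
  by (rule GLO_I[of _ "m2 1 0 (- x) 1"]) (simp_all add: inv_pair_def m2_one)

lemma GLO_upper: "x \<in> I 0 \<Longrightarrow> m2 1 x 0 1 \<in> GLO"
  by (rule GLO_I[of _ "m2 1 (- x) 0 1"]) (simp_all add: inv_pair_def m2_one)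

text \<open>The pivot \<open>a\<close> divides its row and its column with integral quotients, so
  one lower and one upper unipotent matrix clear them.\<close>

lemma cartan_pivot:
  assumes "a \<noteq> 0" "b \<in> I (w a)" "c \<in> I (w a)"
  shows "\<exists>k\<in>GLO. \<exists>l\<in>GLO. \<exists>x y. m2 a b c d = k ** m2 x 0 0 y ** l"
proof -
  have "m2 a b c d = m2 1 0 (c * inverse a) 1 ** m2 a 0 0 (d - c * inverse a * b) ** m2 1 (inverse a * b) 0 1"
    using assms(1) by (simp add: mult.assoc[symmetric] distrib_left) (simp add: mult.assoc)
  moreover have "c * inverse a \<in> I 0" "inverse a * b \<in> I 0"
    using assms by (auto simp: I_mult_iff I_mult_iff' w_inverse)
  ultimately show ?thesis using GLO_lower GLO_upper by blast
qed

text \<open>Swaps of rows and columns bring an entry of least value to the pivot position.\<close>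

lemma cartan_decomposition:
  assumes g: "inv_pair g h"
  obtains k l x y where "k \<in> GLO" "l \<in> GLO" "x \<noteq> 0" "y \<noteq> 0" "g = k ** m2 x 0 0 y ** l"
proof -
  let ?s = "m2 0 1 1 0 :: 'b^2^2"
  obtain a b c d where abcd: "g = m2 a b c d" by (rule m2_cases)
  obtain h1 h2 h3 h4 where h: "h = m2 h1 h2 h3 h4" by (rule m2_cases)
  have "a \<noteq> 0 \<or> b \<noteq> 0" using g by (auto simp: abcd h inv_pair_def m2_one)
  then have "\<exists>y. y \<in> {a, b, c, d} \<and> y \<noteq> 0" by blast
  then obtain y where y: "y \<in> {a, b, c, d}" "y \<noteq> 0"
    and min: "\<And>z. z \<in> {a, b, c, d} \<Longrightarrow> z \<in> I (w y)"
  proof -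
    let ?S = "{z \<in> {a, b, c, d}. z \<noteq> 0}"
    assume *: "\<exists>y. y \<in> {a, b, c, d} \<and> y \<noteq> 0"
      and that: "\<And>y. y \<in> {a, b, c, d} \<Longrightarrow> y \<noteq> 0 \<Longrightarrow> (\<And>z. z \<in> {a, b, c, d} \<Longrightarrow> z \<in> I (w y)) \<Longrightarrow> thesis"
    have fin: "finite ?S" "?S \<noteq> {}" using * by auto
    define y where "y = arg_min_on w ?S"
    have "y \<in> ?S" unfolding y_def by (rule arg_min_if_finite(1)[OF fin])
    moreover have "w y \<le> w z" if "z \<in> ?S" for z
      unfolding y_def by (rule arg_min_least[OF fin that])
    ultimately show thesis by (intro that[of y]) (auto simp: I_def)
  qed
  have "\<exists>k\<in>GLO. \<exists>l\<in>GLO. \<exists>x y. g = k ** m2 x 0 0 y ** l"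
  proof -
    consider "y = a" | "y = b" | "y = c" | "y = d" using y by blast
    then show ?thesis
    proof cases
      case 1
      then show ?thesis unfolding abcd using y min by (intro cartan_pivot) auto
    next
      case 2
      then obtain k l x y where kl: "k \<in> GLO" "l \<in> GLO" "m2 b a d c = k ** m2 x 0 0 y ** l"
        using cartan_pivot[of b a d c] y min by blast
      have "g = m2 b a d c ** ?s" by (simp add: abcd)
      then have "g = k ** m2 x 0 0 y ** (l ** ?s)" using kl by (simp add: matrix_mul_assoc)
      then show ?thesis using kl GLO_mult[OF _ GLO_swap] by blast
    next
      case 3
      then obtain k l x y where kl: "k \<in> GLO" "l \<in> GLO" "m2 c d a b = k ** m2 x 0 0 y ** l"
        using cartan_pivot[of c d a b] y min by blast
      have "g = ?s ** m2 c d a b" by (simp add: abcd)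
      then have "g = (?s ** k) ** m2 x 0 0 y ** l" using kl by (simp add: matrix_mul_assoc)
      then show ?thesis using kl GLO_mult[OF GLO_swap] by blast
    next
      case 4
      then obtain k l x y where kl: "k \<in> GLO" "l \<in> GLO" "m2 d c b a = k ** m2 x 0 0 y ** l"
        using cartan_pivot[of d c b a] y min by blast
      have "g = ?s ** m2 d c b a ** ?s" by (simp add: abcd)
      then have "g = (?s ** k) ** m2 x 0 0 y ** (l ** ?s)" using kl by (simp add: matrix_mul_assoc)
      then show ?thesis using kl GLO_mult[OF GLO_swap] GLO_mult[OF _ GLO_swap] by blast
    qed
  qed
  then obtain k l x y where kl: "k \<in> GLO" "l \<in> GLO" "g = k ** m2 x 0 0 y ** l" by blast
  obtain k' l' where kl': "inv_pair k k'" "inv_pair l l'" using kl by (auto simp: GLO_def)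
  have "inv_pair (k' ** g ** l') (l ** (h ** k))"
    using kl' g by (intro inv_pair_mult) (auto intro: inv_pair_sym)
  also have "k' ** g ** l' = m2 x 0 0 y" using kl' by (simp add: kl(3) matrix_mul_assoc)
  finally show thesis using that kl inv_pair_upperD by blast
qed

text \<open>Column operations clear one entry of the bottom row by the other, the pivot being the
  one of smaller value; a column swap covers the remaining case.\<close>

lemma iwasawa_decomposition:
  assumes g: "inv_pair g h"
  obtains l p x q where "l \<in> GLO" "p \<noteq> 0" "q \<noteq> 0" "g = m2 p x 0 q ** l"
proof -
  let ?s = "m2 0 1 1 0 :: 'b^2^2"
  obtain a b c d where abcd: "g = m2 a b c d" by (rule m2_cases)
  obtain h1 h2 h3 h4 where h: "h = m2 h1 h2 h3 h4" by (rule m2_cases)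
  have cd: "c \<noteq> 0 \<or> d \<noteq> 0" using g by (auto simp: abcd h inv_pair_def m2_one)
  have pivot: "\<exists>l\<in>GLO. \<exists>p x q. m2 a b c d = m2 p x 0 q ** l" if "d \<noteq> 0" "c \<in> I (w d)" for a b c d
  proof -
    have "m2 a b c d = m2 (a - b * inverse d * c) b 0 d ** m2 1 0 (inverse d * c) 1"
      using that by (simp add: mult.assoc[symmetric])
    moreover have "inverse d * c \<in> I 0" using that by (simp add: I_mult_iff w_inverse)
    ultimately show ?thesis using GLO_lower by blast
  qed
  have "\<exists>l\<in>GLO. \<exists>p x q. g = m2 p x 0 q ** l"
  proof (cases "d \<noteq> 0 \<and> c \<in> I (w d)")
    case True
    then show ?thesis using pivot by (simp add: abcd)
  next
    case False
    then have "c \<noteq> 0" "d \<in> I (w c)" using cd by (auto simp: I_def)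
    then obtain l p x q where l: "l \<in> GLO" "m2 b a d c = m2 p x 0 q ** l" using pivot by blast
    have "g = m2 b a d c ** ?s" by (simp add: abcd)
    then have "g = m2 p x 0 q ** (l ** ?s)" using l by (simp add: matrix_mul_assoc)
    then show ?thesis using l GLO_mult[OF _ GLO_swap] by blast
  qed
  then obtain l p x q where l: "l \<in> GLO" "g = m2 p x 0 q ** l" by blast
  obtain l' where l': "inv_pair l l'" using l by (auto simp: GLO_def)
  have "inv_pair (g ** l') (l ** h)" using l' g by (intro inv_pair_mult) (auto intro: inv_pair_sym)
  also have "g ** l' = m2 p x 0 q" using l' by (simp add: l(2))
  finally show thesis using that l inv_pair_upperD by blast
qed

section \<open>Scalars in an intersection of three maximal orders\<close>

text \<open>The factor \<open>l\<close> fixes the standard lattice, so \<open>g\<close> and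
  \<open>u ** t\<close> give the same order. In the basis \<open>u\<close> it remains to see that
  the conjugate by \<open>t\<close> is integral.\<close>

lemma scalar_in_Mc:
  assumes u: "inv_pair u u'" and gh: "inv_pair g h" and t: "inv_pair t t'" and l: "l \<in> GLO"
    and g: "g = u ** t ** l" and a: "t' ** m2 a 0 0 a ** t \<in> M 0"
  shows "u ** m2 a 0 0 a ** u' \<in> Mc g h 0"
proof -
  obtain l' where l': "inv_pair l l'" "l' \<in> M 0" using l by (auto simp: GLO_def)
  have "h ** u = h ** (u ** t ** l) ** l' ** t'" using l' t by (simp add: matrix_mul_assoc)
  also have "\<dots> = l' ** t'" using gh by (simp flip: g)
  finally have hu: "h ** u = l' ** t'" .
  have "u' ** g = t ** l" using u by (simp add: g matrix_mul_assoc)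
  then have "(h ** u) ** m2 a 0 0 a ** (u' ** g) = l' ** (t' ** m2 a 0 0 a ** t) ** l"
    unfolding hu by (simp only: matrix_mul_assoc)
  also have "\<dots> \<in> M 0" using M_mult0[OF M_mult0[OF l'(2) a]] l by (auto simp: GLO_def)
  finally show ?thesis by (simp only: Mc_iff matrix_mul_assoc)
qed

lemma conj_scalar_diagonal:
  assumes "x \<noteq> 0" "y \<noteq> 0" "a \<in> I 0"
  shows "m2 (inverse x) 0 0 (inverse y) ** m2 a 0 0 a ** m2 x 0 0 y \<in> M 0"
  using assms by (simp add: I_prod_conj)

text \<open>Three vertices of the tree lie on the union of the three lines joining some three ends, and
  \<open>GL\<^sub>2(B)\<close> is transitive on triples of ends; the ends \<open>0\<close>, \<open>1\<close>, \<open>\<infinity>\<close> are fixed by scalar matrices.\<close>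

lemma three_orders_contain_scalars:
  assumes g1: "inv_pair g1 h1" and g2: "inv_pair g2 h2" and g3: "inv_pair g3 h3"
  obtains u u' where "inv_pair u u'"
    "\<And>a. a \<in> I 0 \<Longrightarrow> u ** m2 a 0 0 a ** u' \<in> Mc g1 h1 0 \<inter> Mc g2 h2 0 \<inter> Mc g3 h3 0"
proof -
  \<comment> \<open>This gives a basis \<open>u = g1 ** k\<close> adapted to the first two lattices:
    relative to it both are diagonal.\<close>
  obtain k l x y where kl: "k \<in> GLO" "l \<in> GLO" "x \<noteq> 0" "y \<noteq> 0" "h1 ** g2 = k ** m2 x 0 0 y ** l"
    using cartan_decomposition[OF inv_pair_mult[OF inv_pair_sym[OF g1] g2]] .
  obtain k' where k': "inv_pair k k'" "k' \<in> M 0" using kl by (auto simp: GLO_def)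
  then have k'G: "k' \<in> GLO" using kl(1) by (auto simp: GLO_def intro: inv_pair_sym)
  define u where "u = g1 ** k"
  define u' where "u' = k' ** h1"
  have u: "inv_pair u u'" unfolding u_def u'_def by (rule inv_pair_mult[OF g1 k'(1)])
  have e1: "g1 = u ** mat 1 ** k'" using k' by (simp add: u_def)
  have "g2 = g1 ** (h1 ** g2)" using g1 by (simp add: matrix_mul_assoc)
  then have e2: "g2 = u ** m2 x 0 0 y ** l" by (simp add: kl(5) u_def matrix_mul_assoc)
  \<comment> \<open>In the basis \<open>u\<close> the third lattice is upper triangular, which
    leaves the entry \<open>z\<close> as the only obstruction.\<close>
  obtain m p z q where m: "m \<in> GLO" "p \<noteq> 0" "q \<noteq> 0" "u' ** g3 = m2 p z 0 q ** m"
    using iwasawa_decomposition[OF inv_pair_mult[OF inv_pair_sym[OF u] g3]] .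
  have "g3 = u ** (u' ** g3)" using u by (simp add: matrix_mul_assoc)
  then have e3: "g3 = u ** m2 p z 0 q ** m" by (simp add: m(4) matrix_mul_assoc)
  have diag: "inv_pair (m2 r 0 0 s) (m2 (inverse r) 0 0 (inverse s))" if "r \<noteq> 0" "s \<noteq> 0" for r s :: 'b
    using inv_pair_upper[OF that, of 0] by simp
  show thesis
  proof (cases "z = 0")
    case True
    have "u ** m2 a 0 0 a ** u' \<in> Mc g1 h1 0 \<inter> Mc g2 h2 0 \<inter> Mc g3 h3 0" if a: "a \<in> I 0" for a
    proof (intro IntI)
      show "u ** m2 a 0 0 a ** u' \<in> Mc g1 h1 0"
        using a by (intro scalar_in_Mc[OF u g1 inv_pair_one k'G e1]) simp
      show "u ** m2 a 0 0 a ** u' \<in> Mc g2 h2 0"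
        by (rule scalar_in_Mc[OF u g2 diag[OF kl(3,4)] kl(2) e2 conj_scalar_diagonal[OF kl(3,4) a]])
      show "u ** m2 a 0 0 a ** u' \<in> Mc g3 h3 0"
        using scalar_in_Mc[OF u g3 diag[OF m(2,3)] m(1) _ conj_scalar_diagonal[OF m(2,3) a]] e3 True by blast
    qed
    then show thesis using that u by blast
  next
    case False
    \<comment> \<open>Rescaling the basis by \<open>z\<close> and \<open>q\<close> keeps the first
      two lattices diagonal and turns the second column of the third into \<open>(1, 1)\<close>,
      whose line is kept by scalar matrices.\<close>
    define t where "t = u ** m2 z 0 0 q"
    define t' where "t' = m2 (inverse z) 0 0 (inverse q) ** u'"
    have t: "inv_pair t t'" unfolding t_def t'_def by (rule inv_pair_mult[OF u diag[OF False m(3)]])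
    have "m2 z 0 0 q ** m2 (inverse z) 0 0 (inverse q) = mat 1"
      using False m by (simp add: m2_one)
    then have f1: "g1 = t ** m2 (inverse z) 0 0 (inverse q) ** k'"
      using e1 by (simp add: t_def flip: matrix_mul_assoc)
    have "m2 z 0 0 q ** m2 (inverse z * x) 0 0 (inverse q * y) = m2 x 0 0 y"
      using False m by (simp add: mult.assoc[symmetric])
    then have f2: "g2 = t ** m2 (inverse z * x) 0 0 (inverse q * y) ** l"
      using e2 by (simp add: t_def flip: matrix_mul_assoc)
    have "m2 z 0 0 q ** m2 (inverse z * p) 1 0 1 = m2 p z 0 q"
      using False m by (simp add: mult.assoc[symmetric])
    then have f3: "g3 = t ** m2 (inverse z * p) 1 0 1 ** m"
      using e3 by (simp add: t_def flip: matrix_mul_assoc)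
    define r where "r = inverse z * p"
    have nz: "inverse z \<noteq> 0" "inverse q \<noteq> 0" "inverse z * x \<noteq> 0" "inverse q * y \<noteq> 0" "r \<noteq> 0"
      using False m kl by (auto simp: r_def)
    have "t ** m2 a 0 0 a ** t' \<in> Mc g1 h1 0 \<inter> Mc g2 h2 0 \<inter> Mc g3 h3 0" if a: "a \<in> I 0" for a
    proof (intro IntI)
      show "t ** m2 a 0 0 a ** t' \<in> Mc g1 h1 0"
        by (rule scalar_in_Mc[OF t g1 diag[OF nz(1,2)] k'G f1 conj_scalar_diagonal[OF nz(1,2) a]])
      show "t ** m2 a 0 0 a ** t' \<in> Mc g2 h2 0"
        by (rule scalar_in_Mc[OF t g2 diag[OF nz(3,4)] kl(2) f2 conj_scalar_diagonal[OF nz(3,4) a]])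
      \<comment> \<open>The conjugate is diagonal, because its two off-diagonal terms
        \<open>inverse r * a\<close> cancel.\<close>
      have "m2 (inverse r) (- (inverse r * 1 * inverse 1)) 0 (inverse 1) ** m2 a 0 0 a ** m2 r 1 0 1 \<in> M 0"
        using a nz by (simp add: I_prod_conj)
      then show "t ** m2 a 0 0 a ** t' \<in> Mc g3 h3 0"
        using scalar_in_Mc[OF t g3 inv_pair_upper[OF nz(5), of 1 1] m(1)] f3 by (simp add: r_def)
    qed
    then show thesis using that t by blast
  qed
qed

text \<open>In the basis \<open>g\<close> the scalar matrix of \<open>b\<close> is conjugated by
  \<open>s\<close>. Passing to powers does not enlarge the distortion caused by \<open>s\<close> and
  its inverse, so \<open>b ^ m\<close> has value at least \<open>m * j\<close> up to a
  constant.\<close>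

lemma scalar_in_Mc_imp:
  assumes u: "inv_pair u u'" and gh: "inv_pair g h" and b: "u ** m2 b 0 0 b ** u' \<in> Mc g h j"
  shows "b \<in> I j"
proof (cases "b = 0")
  case False
  define s where "s = h ** u"
  define s' where "s' = u' ** g"
  have s: "inv_pair s s'" unfolding s_def s'_def by (rule inv_pair_mult[OF inv_pair_sym[OF gh] u])
  obtain i k where i: "s \<in> M i" and k: "s' \<in> M k" using M_exhaust by metis
  have sb: "s ** m2 b 0 0 b ** s' \<in> M j" using b by (simp add: Mc_iff s_def s'_def matrix_mul_assoc)
  have "b ^ m \<in> I (int m * j - (- (k + (0 + i))))" for m
  proof -
    have "s ** m2 (b ^ m) 0 0 (b ^ m) ** s' \<in> M (int m * j)"
    proof (induction m)
      case 0
      have "s ** m2 1 0 0 1 ** s' = mat 1" using s by (simp flip: m2_one)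
      then show ?case by simp
    next
      case (Suc m)
      have "s ** m2 (b ^ Suc m) 0 0 (b ^ Suc m) ** s' =
        (s ** m2 b 0 0 b ** s') ** (s ** m2 (b ^ m) 0 0 (b ^ m) ** s')"
        by (subst conj_mult[OF inv_pair_sym[OF s], symmetric]) simp
      also have "\<dots> \<in> M (j + int m * j)" by (rule M_mult[OF sb Suc])
      finally show ?case by (simp add: algebra_simps)
    qed
    then have "s' ** (s ** m2 (b ^ m) 0 0 (b ^ m) ** s') ** s \<in> M (k + int m * j + i)"
      using i k by (intro M_mult)
    then show ?thesis by (simp add: conj_cancel[OF s] algebra_simps)
  qed
  from w_ge_if_powers_ge[OF False this] show ?thesis by (simp add: I_def)
qed simp

text \<open>The scalars common to the three orders form a copy of \<open>O\<close> with commutators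
  in the square of the maximal ideal. Hence \<open>O\<close> is commutative modulo
  \<open>P^2\<close>, and then \<open>B\<close> is commutative.\<close>

lemma not_intersection_of_three:
  assumes nc: "\<exists>x y :: 'b. x * y \<noteq> y * x" and gh: "inv_pair g h"
    and D: "is_maximal_order v smul D1" "is_maximal_order v smul D2" "is_maximal_order v smul D3"
    and sub: "D1 \<inter> D2 \<inter> D3 \<subseteq> order_sq (Mc g h 0)"
  shows False
proof -
  obtain g1 h1 g2 h2 g3 h3 where
    D1: "inv_pair g1 h1" "D1 = Mc g1 h1 0" and D2: "inv_pair g2 h2" "D2 = Mc g2 h2 0"
    and D3: "inv_pair g3 h3" "D3 = Mc g3 h3 0"
    using D unfolding maximal_order_iff by metis
  obtain u u' where u: "inv_pair u u'" and
    U: "\<And>a. a \<in> I 0 \<Longrightarrow> u ** m2 a 0 0 a ** u' \<in> D1 \<inter> D2 \<inter> D3"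
    using three_orders_contain_scalars[OF D1(1) D2(1) D3(1)] unfolding D1(2) D2(2) D3(2) by metis
  have "a * b - b * a \<in> I 2" if a: "a \<in> I 0" and b: "b \<in> I 0" for a b
  proof (rule scalar_in_Mc_imp[OF u gh])
    let ?U = "\<lambda>a. u ** m2 a 0 0 a ** u'"
    have "?U a \<in> order_sq (Mc g h 0)" "?U b \<in> order_sq (Mc g h 0)" using U[OF a] U[OF b] sub by auto
    then have "?U a ** ?U b - ?U b ** ?U a \<in> Mc g h 2" by (simp add: order_sq_Mc[OF gh])
    also have "?U a ** ?U b - ?U b ** ?U a = ?U (a * b - b * a)"
      unfolding conj_mult[OF inv_pair_sym[OF u], symmetric]
        matrix_mul_diff_right[symmetric] matrix_mul_diff_left[symmetric] by simp
    finally show "?U (a * b - b * a) \<in> Mc g h 2" .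
  qed
  then show False using commutative_if_commutative_mod_square nc by blast
qed

end

theorem theorem1p2:
  fixes v :: "'k::field \<Rightarrow> int"
    and smul :: "'k \<Rightarrow> 'b::division_ring \<Rightarrow> 'b"
    and n :: nat
    and D :: "('b^2^2) set"
  assumes "nonarchimedean_local_field v"
    and "central_division_algebra smul"
    and "0 < n"
    and "vector_space.dim smul (UNIV :: 'b set) = n\<^sup>2"
    and "\<exists>x y :: 'b. x * y \<noteq> y * x"
    and "is_maximal_order v smul D"
  shows "(\<forall>H. is_order v smul H \<and> H \<subseteq> order_sq D \<longrightarrow>
            \<not> (\<exists>D1 D2 D3. is_maximal_order v smul D1 \<and> is_maximal_order v smul D2 \<and>
                 is_maximal_order v smul D3 \<and> H = D1 \<inter> D2 \<inter> D3)) \<and>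
         (\<exists>F. finite F \<and> F \<noteq> {} \<and> (\<forall>D'\<in>F. is_maximal_order v smul D') \<and> order_sq D = \<Inter>F)"
proof -
  interpret nonarchimedean_local_field v by fact
  interpret central_division_algebra smul by fact
  obtain E :: "'b set" where E: "independent E" "span E = UNIV" "card E = n\<^sup>2"
    using basis_exists[of UNIV] assms(4) by (metis UNIV_I span_UNIV subset_UNIV subset_antisym subsetI)
  \<comment> \<open>\<open>card\<close> is 0 on infinite sets, so a positive value makes
    \<open>E\<close> finite as well as nonempty.\<close>
  have card: "0 < card E" using E(3) assms(3) by simp
  interpret B: division_algebra_over_local_field v smul E
    using card_ge_0_finite[OF card] E by unfold_locales
  obtain w e where w: "discretely_valued_division_ring w" "0 < e"
    "\<And>a x. a \<noteq> 0 \<Longrightarrow> x \<noteq> 0 \<Longrightarrow> w (smul a x) = e * v a + w x"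
    "\<exists>F. finite F \<and> valuation.I w 0 = int_span v smul F"
    using B.extended_valuation_exists card by (auto simp: card_gt_0_iff)
  interpret w: discretely_valued_division_ring w by (rule w(1))
  interpret V: valued_division_algebra v smul w e
    using w(2-4) by unfold_locales auto
  obtain g h where gh: "inv_pair g h" and D: "D = V.Mc g h 0"
    using assms(6) V.maximal_order_iff by blast
  show ?thesis
    unfolding D using V.not_intersection_of_three[OF assms(5) gh] V.order_sq_is_intersection[OF gh] by blast
qed

end
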